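(* For $\mathcal L_2$-almost every $\lambda\in\mathcal M\cap B_{1/\sqrt2}(0)$ we have $\dim_H(A_\lambda)=s(\lambda)$. Moreover, for any $0<r<R<1/\sqrt2$, $$\dim_H\{\lambda\in\mathcal M:\ r<|\lambda|<R,\ \dim_H A_\lambda<s(\lambda)\}\le\frac{\log2}{-\log R}<2.$$
   Context: $\mathcal L_2$ is Lebesgue (area) measure on $\mathbb C$; $B_r(0)$ is the open disc of radius $r$ about $0$. $A_\lambda=\{\sum_{n\ge0}a_n\lambda^n:a_n\in\{-1,1\}\}$ and $\mathcal M=\{\lambda\in\mathbb D:\ \exists (a_k)_{k\ge1},\ a_k\in\{-1,0,1\},\ 1+\sum_{k\ge1}a_k\lambda^k=0\}$ (the set of $\lambda$ in the unit disc $\mathbb D$ with $A_\lambda$ connected). $s(\lambda)=\frac{\log2}{-\log|\lambda|}$ is the similarity dimension. $\dim_H$ is Hausdorff dimension. *)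

theory Defs
  imports "HOL-Analysis.Analysis"
begin

text \<open>Contribution of one covering set to the s-dimensional Hausdorff sum:
  |U|^s, with the conventions |{}|^s = 0 and (for nonempty U of diameter 0) 0^s = 0 for s > 0.\<close>
definition hcost :: "real \<Rightarrow> 'a::metric_space set \<Rightarrow> ennreal" where
  "hcost s U = (if U = {} then 0 else ennreal (diameter U powr s))"

definition hausdorff_pre :: "real \<Rightarrow> real \<Rightarrow> 'a::metric_space set \<Rightarrow> ennreal" where
  "hausdorff_pre s \<delta> E =
     (INF U \<in> {U :: nat \<Rightarrow> 'a set. E \<subseteq> (\<Union>i. U i) \<and> (\<forall>i. bounded (U i) \<and> diameter (U i) \<le> \<delta>)}.
        (\<Sum>i. hcost s (U i)))"

definition hausdorff_measure :: "real \<Rightarrow> 'a::metric_space set \<Rightarrow> ennreal" where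
  "hausdorff_measure s E = (SUP \<delta> \<in> {0<..}. hausdorff_pre s \<delta> E)"

definition hausdorff_dim :: "'a::metric_space set \<Rightarrow> real" where
  "hausdorff_dim E = Inf {s. s > 0 \<and> hausdorff_measure s E = 0}"

definition A_set :: "complex \<Rightarrow> complex set" where
  "A_set z = {(\<Sum>n. of_int (a n) * z ^ n) | a. \<forall>n. a n \<in> {-1, 1}}"

definition M_set :: "complex set" where
  "M_set = {z. norm z < 1 \<and> (\<exists>a :: nat \<Rightarrow> int. (\<forall>k. a k \<in> {-1, 0, 1}) \<and>
                 1 + (\<Sum>k. of_int (a (Suc k)) * z ^ (Suc k)) = 0)}"

definition sim_dim :: "complex \<Rightarrow> real" where
  "sim_dim z = ln 2 / (- ln (norm z))"

end

theory Submission
  imports Defs "HOL-Complex_Analysis.Great_Picard"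
begin

text \<open>
  For words u, v of length m over {-1, 1} write u(z), v(z) for the sums of their letters against
  powers of z, and let N m be the number of pairs with |u(z) - v(z)| \<le> K |z|^m. If N m = O(b^m),
  then most words have few neighbours at every scale, and a finite mass distribution argument shows
  that A_z is not a null set in dimension t whenever b < 4 |z|^t; for b close to 2 this allows every
  t < s(z). So it suffices to bound, for each b > 2, the set of z with |z| \<le> R for which N m / b^m
  is unbounded.

  No transversality is available, since power series with coefficients -1, 0, 1 may have multiple
  zeros in the disc; but they form a normal family, so some derivative of order at most J is bounded
  below. At a level m where N m / b^m is a record, a fixed proportion of the close pairs differ in
  the first letter. For each of them choose the first derivative order j + 1 at which u - v is not
  small at z, on a scale k = m div q^j: then the prefixes of length k have a j-th derivative of size
  about R^k at z and a much larger (j + 1)-st derivative, so they determine z up to about R^k. Each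
  pair of prefixes has at most 36 N (m - k) extensions, so by the record property z sees at least
  c b^k of the 4^k pairs of prefixes. Hence about (4/b)^k discs of radius about R^k cover all such
  z, and since R^s = 1/2 for s = log 2 / (- log R), the s-th powers of their diameters are summable
  over k.
\<close>

section \<open>Hausdorff null sets\<close>

lemma hcost_eq: "hcost s U = ennreal (diameter U powr s)"
  by (simp add: hcost_def)

lemma hausdorff_pre_le:
  assumes "E \<subseteq> (\<Union>i. U i)" "\<And>i. bounded (U i)" "\<And>i. diameter (U i) \<le> \<delta>"
  shows "hausdorff_pre s \<delta> E \<le> (\<Sum>i. hcost s (U i))"
  unfolding hausdorff_pre_def by (rule INF_lower) (use assms in auto)

lemma hausdorff_pre_mono:
  assumes "E \<subseteq> F" shows "hausdorff_pre s \<delta> E \<le> hausdorff_pre s \<delta> F"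
  unfolding hausdorff_pre_def by (rule INF_superset_mono) (use assms in auto)

lemma hausdorff_pre_lessE:
  assumes "hausdorff_pre s \<delta> E < c"
  obtains U where "E \<subseteq> (\<Union>i. U i)" "\<And>i. bounded (U i)" "\<And>i. diameter (U i) \<le> \<delta>"
    "(\<Sum>i. hcost s (U i)) < c"
  using assms unfolding hausdorff_pre_def INF_less_iff by blast

lemma suminf_ennreal_halves:
  assumes "0 \<le> e" shows "(\<Sum>k. ennreal (e * (1/2) ^ Suc k)) = ennreal e"
proof -
  have "(\<lambda>k. e * (1/2) ^ Suc k) sums (e * 1)"
    by (intro sums_mult power_half_series)
  then show ?thesis using assms by (intro suminf_ennreal_eq) auto
qed

lemma hausdorff_pre_UN_le_suminf:
  fixes U :: "nat \<Rightarrow> nat \<Rightarrow> 'a::metric_space set"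
  assumes cover: "\<And>k. E k \<subseteq> (\<Union>i. U k i)"
    and small: "\<And>k i. bounded (U k i)" "\<And>k i. diameter (U k i) \<le> \<delta>"
  shows "hausdorff_pre s \<delta> (\<Union>k. E k) \<le> (\<Sum>k. \<Sum>i. hcost s (U k i))"
proof -
  define V where "V n = (case prod_decode n of (k, i) \<Rightarrow> U k i)" for n
  have "hausdorff_pre s \<delta> (\<Union>k. E k) \<le> (\<Sum>n. hcost s (V n))"
  proof (rule hausdorff_pre_le)
    show "(\<Union>k. E k) \<subseteq> (\<Union>n. V n)"
    proof
      fix x assume "x \<in> (\<Union>k. E k)"
      then obtain k i where "x \<in> U k i" using cover by blast
      then have "x \<in> V (prod_encode (k, i))" by (simp add: V_def)
      then show "x \<in> (\<Union>n. V n)" by blast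
    qed
  qed (auto simp: V_def small split: prod.split)
  also have "\<dots> = (\<Sum>n. (\<lambda>(k, i). hcost s (U k i)) (prod_decode n))"
    by (simp add: V_def case_prod_unfold)
  also have "\<dots> = (\<Sum>k. \<Sum>i. hcost s (U k i))"
    by (rule suminf_ennreal_2dimen) simp
  finally show ?thesis .
qed

lemma hausdorff_pre_UN:
  fixes E :: "nat \<Rightarrow> 'a::metric_space set"
  shows "hausdorff_pre s \<delta> (\<Union>k. E k) \<le> (\<Sum>k. hausdorff_pre s \<delta> (E k))"
proof (rule ennreal_le_epsilon)
  fix e :: real assume "0 < e" and finite_sum: "(\<Sum>k. hausdorff_pre s \<delta> (E k)) < top"
  let ?bound = "\<lambda>k. hausdorff_pre s \<delta> (E k) + ennreal (e * (1/2) ^ Suc k)"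
  have "\<exists>U. E k \<subseteq> (\<Union>i. U i) \<and> (\<forall>i. bounded (U i) \<and> diameter (U i) \<le> \<delta>) \<and>
          (\<Sum>i. hcost s (U i)) < ?bound k" for k
  proof -
    have "hausdorff_pre s \<delta> (E k) < top"
      using finite_sum ennreal_suminf_lessD by blast
    then have "hausdorff_pre s \<delta> (E k) + 0 < ?bound k"
      unfolding ennreal_add_left_cancel_less using \<open>0 < e\<close> by (simp add: less_top)
    then have "hausdorff_pre s \<delta> (E k) < ?bound k" unfolding add_0_right .
    then show ?thesis
      by (rule hausdorff_pre_lessE) blast
  qed
  then obtain U where U: "\<And>k. E k \<subseteq> (\<Union>i. U k i)" "\<And>k i. bounded (U k i)"
    "\<And>k i. diameter (U k i) \<le> \<delta>" "\<And>k. (\<Sum>i. hcost s (U k i)) < ?bound k"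
    using that by (meson choice_iff)
  have "hausdorff_pre s \<delta> (\<Union>k. E k) \<le> (\<Sum>k. \<Sum>i. hcost s (U k i))"
    by (rule hausdorff_pre_UN_le_suminf[OF U(1-3)])
  also have "\<dots> \<le> (\<Sum>k. ?bound k)"
    by (intro suminf_le less_imp_le U(4)) auto
  also have "\<dots> = (\<Sum>k. hausdorff_pre s \<delta> (E k)) + (\<Sum>k. ennreal (e * (1/2) ^ Suc k))"
    by (intro suminf_add[symmetric]) auto
  also have "(\<Sum>k. ennreal (e * (1/2) ^ Suc k)) = ennreal e"
    using \<open>0 < e\<close> by (intro suminf_ennreal_halves) simp
  finally show "hausdorff_pre s \<delta> (\<Union>k. E k) \<le> (\<Sum>k. hausdorff_pre s \<delta> (E k)) + ennreal e" .
qed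

lemma hausdorff_measure_eq_0_iff:
  "hausdorff_measure s E = 0 \<longleftrightarrow> (\<forall>\<delta>>0. hausdorff_pre s \<delta> E = 0)"
  unfolding hausdorff_measure_def bot_ennreal[symmetric] by (auto simp: SUP_bot_conv)

lemma hausdorff_measure_eq_0_subset:
  assumes "hausdorff_measure s F = 0" "E \<subseteq> F" shows "hausdorff_measure s E = 0"
  using assms hausdorff_pre_mono[of E F s] unfolding hausdorff_measure_eq_0_iff
  by (metis le_zero_eq)

lemma hausdorff_measure_eq_0_UN:
  fixes E :: "nat \<Rightarrow> 'a::metric_space set"
  assumes "\<And>k. hausdorff_measure s (E k) = 0" shows "hausdorff_measure s (\<Union>k. E k) = 0"
  unfolding hausdorff_measure_eq_0_iff
proof safe
  fix \<delta> :: real assume "\<delta> > 0"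
  then have "hausdorff_pre s \<delta> (E k) = 0" for k
    using assms hausdorff_measure_eq_0_iff by blast
  then show "hausdorff_pre s \<delta> (\<Union>k. E k) = 0"
    using hausdorff_pre_UN[of s \<delta> E] by simp
qed

lemma hausdorff_pre_finite_cball_cover:
  fixes X :: "'a::euclidean_space set"
  assumes X: "finite X" "E \<subseteq> (\<Union>x\<in>X. cball x r)" and r: "0 \<le> r" "2 * r \<le> \<delta>"
  shows "hausdorff_pre s \<delta> E \<le> ennreal (real (card X) * (2 * r) powr s)"
proof -
  obtain f where f: "bij_betw f {..<card X} X"
    using ex_bij_betw_nat_finite[OF X(1)] by (auto simp: atLeast0LessThan)
  define U where "U i = (if i < card X then cball (f i) r else {})" for i
  have "hausdorff_pre s \<delta> E \<le> (\<Sum>i. hcost s (U i))"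
  proof (rule hausdorff_pre_le)
    show "E \<subseteq> (\<Union>i. U i)"
    proof
      fix x assume "x \<in> E"
      then have "x \<in> (\<Union>y\<in>f ` {..<card X}. cball y r)"
        using X(2) unfolding bij_betw_imp_surj_on[OF f] by blast
      then obtain i where "i < card X" "x \<in> cball (f i) r" by blast
      then have "x \<in> U i" by (simp add: U_def)
      then show "x \<in> (\<Union>i. U i)" by blast
    qed
  qed (use r in \<open>auto simp: U_def\<close>)
  also have "\<dots> = (\<Sum>i<card X. hcost s (U i))"
    by (rule suminf_finite) (auto simp: U_def hcost_def)
  also have "\<dots> = (\<Sum>i<card X. ennreal ((2 * r) powr s))"
    using r by (intro sum.cong) (auto simp: U_def hcost_eq)
  also have "\<dots> = ennreal (real (card X) * (2 * r) powr s)"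
    by (simp add: ennreal_mult' ennreal_of_nat_eq_real_of_nat)
  finally show ?thesis .
qed

lemma hausdorff_measure_limsup_eq_0:
  fixes B :: "nat \<Rightarrow> 'a::metric_space set"
  assumes cover: "\<And>\<delta>. 0 < \<delta> \<Longrightarrow> \<forall>\<^sub>F k in sequentially. hausdorff_pre s \<delta> (B k) \<le> ennreal (c k)"
    and c: "summable c" "\<And>k. 0 \<le> c k"
  shows "hausdorff_measure s {x. \<exists>\<^sub>F k in sequentially. x \<in> B k} = 0"
  unfolding hausdorff_measure_eq_0_iff
proof safe
  let ?E = "{x. \<exists>\<^sub>F k in sequentially. x \<in> B k}"
  fix \<delta> :: real assume "\<delta> > 0"
  from cover[OF this] obtain k0 where k0: "\<And>k. k \<ge> k0 \<Longrightarrow> hausdorff_pre s \<delta> (B k) \<le> ennreal (c k)"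
    unfolding eventually_sequentially by blast
  have "hausdorff_pre s \<delta> ?E \<le> 0"
  proof (rule ennreal_le_epsilon)
    fix e :: real assume "0 < e"
    then obtain k1 where k1: "\<And>n. n \<ge> k1 \<Longrightarrow> norm (\<Sum>i. c (i + n)) < e"
      using suminf_exist_split[OF _ c(1)] by blast
    define n where "n = max k0 k1"
    have "?E \<subseteq> (\<Union>k. B (k + n))"
    proof
      fix x assume "x \<in> ?E"
      then obtain k where "k \<ge> n" "x \<in> B k" unfolding frequently_sequentially by blast
      then have "x \<in> B ((k - n) + n)" by simp
      then show "x \<in> (\<Union>k. B (k + n))" by blast
    qed
    then have "hausdorff_pre s \<delta> ?E \<le> hausdorff_pre s \<delta> (\<Union>k. B (k + n))"
      by (rule hausdorff_pre_mono)
    also have "\<dots> \<le> (\<Sum>k. hausdorff_pre s \<delta> (B (k + n)))" by (rule hausdorff_pre_UN)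
    also have "\<dots> \<le> (\<Sum>k. ennreal (c (k + n)))"
      by (intro suminf_le k0) (auto simp: n_def)
    also have "\<dots> = ennreal (\<Sum>k. c (k + n))"
      using c summable_iff_shift[of c n] by (intro suminf_ennreal2) auto
    also have "\<dots> \<le> ennreal e"
      using k1[of n] by (intro ennreal_leI) (auto simp: n_def)
    finally show "hausdorff_pre s \<delta> ?E \<le> 0 + ennreal e" by simp
  qed
  then show "hausdorff_pre s \<delta> ?E = 0" by simp
qed

lemma ex_cball_emeasure_le_hcost:
  fixes U :: "'a::euclidean_space set"
  assumes U: "bounded U" "diameter U \<le> 1" and s: "s \<le> real DIM('a)"
  shows "\<exists>x r. U \<subseteq> cball x r \<and>
    emeasure lebesgue (cball x r) \<le> ennreal (unit_ball_vol (real DIM('a))) * hcost s U"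
proof (intro exI conjI)
  let ?D = "diameter U"
  have D: "0 \<le> ?D" by (rule diameter_ge_0[OF U(1)])
  show "U \<subseteq> cball (SOME x. x \<in> U) ?D"
  proof
    fix x assume "x \<in> U"
    then have "(SOME x. x \<in> U) \<in> U" by (rule someI)
    then show "x \<in> cball (SOME x. x \<in> U) ?D"
      using diameter_bounded_bound[OF U(1) _ \<open>x \<in> U\<close>] by simp
  qed
  have "?D ^ DIM('a) \<le> ?D powr s"
  proof (cases "?D = 0")
    case False
    then have "?D ^ DIM('a) = ?D powr real DIM('a)" using D by (simp add: powr_realpow)
    also have "\<dots> \<le> ?D powr s" using D False U(2) s by (intro powr_mono') auto
    finally show ?thesis .
  qed (simp add: power_0_left)
  then have "ennreal (unit_ball_vol (real DIM('a)) * ?D ^ DIM('a))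
      \<le> ennreal (unit_ball_vol (real DIM('a)) * ?D powr s)"
    by (intro ennreal_leI mult_left_mono) auto
  then show "emeasure lebesgue (cball (SOME x. x \<in> U) ?D)
      \<le> ennreal (unit_ball_vol (real DIM('a))) * hcost s U"
    using D by (simp add: emeasure_cball hcost_eq ennreal_mult')
qed

lemma hausdorff_null_imp_negligible:
  fixes E :: "'a::euclidean_space set"
  assumes null: "hausdorff_measure s E = 0" and s: "s \<le> real DIM('a)"
  shows "negligible E"
  unfolding negligible_outer_le
proof (intro allI impI)
  fix e :: real assume "e > 0"
  define v where "v = unit_ball_vol (real DIM('a))"
  have "0 < v" by (simp add: v_def)
  have "hausdorff_pre s 1 E < ennreal (e / v)"
    using null \<open>e > 0\<close> \<open>0 < v\<close> by (simp add: hausdorff_measure_eq_0_iff)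
  then obtain U where U: "E \<subseteq> (\<Union>i. U i)" "\<And>i. bounded (U i)" "\<And>i. diameter (U i) \<le> 1"
    "(\<Sum>i. hcost s (U i)) < ennreal (e / v)"
    by (rule hausdorff_pre_lessE) blast
  obtain x r where ball: "\<And>i. U i \<subseteq> cball (x i) (r i)"
    "\<And>i. emeasure lebesgue (cball (x i) (r i)) \<le> ennreal v * hcost s (U i)"
    using ex_cball_emeasure_le_hcost[OF U(2,3) s] unfolding v_def by metis
  let ?T = "\<Union>i. cball (x i) (r i)"
  have "emeasure lebesgue ?T \<le> (\<Sum>i. emeasure lebesgue (cball (x i) (r i)))"
    by (rule emeasure_subadditive_countably) auto
  also have "\<dots> \<le> (\<Sum>i. ennreal v * hcost s (U i))"
    by (intro suminf_le ball(2)) auto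
  also have "\<dots> = ennreal v * (\<Sum>i. hcost s (U i))" by simp
  also have "\<dots> \<le> ennreal v * ennreal (e / v)"
    using U(4) by (intro mult_left_mono) auto
  also have "\<dots> = ennreal e" using \<open>0 < v\<close> \<open>e > 0\<close> by (simp flip: ennreal_mult')
  finally have measure_le: "emeasure lebesgue ?T \<le> ennreal e" .
  show "\<exists>T. E \<subseteq> T \<and> T \<in> lmeasurable \<and> measure lebesgue T \<le> e"
  proof (intro exI conjI)
    show "E \<subseteq> ?T" using U(1) ball(1) by blast
    show "?T \<in> lmeasurable"
      using measure_le by (intro fmeasurableI) (auto simp: le_less_trans[OF _ ennreal_less_top])
    show "measure lebesgue ?T \<le> e"
      unfolding measure_def using measure_le \<open>e > 0\<close> by (simp add: enn2real_leI)
  qed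
qed

lemma ex_open_superset_dist_powr_le:
  fixes U :: "'a::metric_space set"
  assumes U: "bounded U" and t: "0 < t" and e: "0 < e"
  shows "\<exists>V d. open V \<and> U \<subseteq> V \<and> 0 < d \<and> (\<forall>x\<in>V. \<forall>y\<in>V. dist x y \<le> d) \<and>
    d powr t \<le> diameter U powr t + e"
proof -
  let ?D = "diameter U"
  have D: "0 \<le> ?D" by (rule diameter_ge_0[OF U])
  have "((\<lambda>x. x powr t) \<longlongrightarrow> ?D powr t) (at_right ?D)"
  proof (rule tendsto_powr2)
    show "\<forall>\<^sub>F x in at_right ?D. 0 \<le> x"
      using eventually_at_right_less[of ?D] by eventually_elim (use D in simp)
  qed (use t in auto)
  then have "\<forall>\<^sub>F x in at_right ?D. x powr t < ?D powr t + e"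
    using e by (intro order_tendstoD) auto
  then have "\<forall>\<^sub>F x in at_right ?D. x powr t < ?D powr t + e \<and> ?D < x"
    by (rule eventually_conj[OF _ eventually_at_right_less])
  then obtain d where d: "d powr t < ?D powr t + e" "?D < d"
    using eventually_happens'[OF trivial_limit_at_right_real] by blast
  let ?V = "\<Union>y\<in>U. ball y ((d - ?D) / 2)"
  have "dist x y \<le> d" if xy: "x \<in> ?V" "y \<in> ?V" for x y
  proof -
    obtain x' where x': "x' \<in> U" "dist x' x < (d - ?D) / 2" using xy(1) by auto
    obtain y' where y': "y' \<in> U" "dist y' y < (d - ?D) / 2" using xy(2) by auto
    have "dist x' y' \<le> ?D" by (rule diameter_bounded_bound[OF U x'(1) y'(1)])
    moreover have "dist x y \<le> dist x' x + dist x' y' + dist y' y"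
      using dist_triangle[of x y x'] dist_triangle[of x' y y'] by (simp add: dist_commute)
    ultimately show ?thesis using x'(2) y'(2) by argo
  qed
  moreover have "U \<subseteq> ?V" using d(2) by force
  ultimately show ?thesis
    using d D by (intro exI[of _ ?V] exI[of _ d]) auto
qed

lemma ex_open_cover_suminf_powr_le:
  fixes U :: "nat \<Rightarrow> 'a::metric_space set"
  assumes U: "\<And>i. bounded (U i)" and t: "0 < t" and e: "0 < e"
  obtains V d where "\<And>i. open (V i)" "\<And>i. U i \<subseteq> V i" "\<And>i. 0 < d i"
    "\<And>i x y. x \<in> V i \<Longrightarrow> y \<in> V i \<Longrightarrow> dist x y \<le> d i"
    "(\<Sum>i. ennreal (d i powr t)) \<le> (\<Sum>i. hcost t (U i)) + ennreal e"
proof -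
  let ?slack = "\<lambda>i. e * (1/2) ^ Suc i"
  have "\<exists>V d. open V \<and> U i \<subseteq> V \<and> 0 < d \<and> (\<forall>x\<in>V. \<forall>y\<in>V. dist x y \<le> d) \<and>
    d powr t \<le> diameter (U i) powr t + ?slack i" for i
    using e by (intro ex_open_superset_dist_powr_le U t) simp
  then obtain V d where V: "\<And>i. open (V i)" "\<And>i. U i \<subseteq> V i" "\<And>i. 0 < d i"
    "\<And>i. \<forall>x\<in>V i. \<forall>y\<in>V i. dist x y \<le> d i" "\<And>i. d i powr t \<le> diameter (U i) powr t + ?slack i"
    by metis
  have "(\<Sum>i. ennreal (d i powr t)) \<le> (\<Sum>i. hcost t (U i) + ennreal (?slack i))"
  proof (intro suminf_le)
    fix i
    have "ennreal (d i powr t) \<le> ennreal (diameter (U i) powr t + ?slack i)"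
      by (rule ennreal_leI[OF V(5)])
    then show "ennreal (d i powr t) \<le> hcost t (U i) + ennreal (?slack i)"
      using e by (simp add: hcost_eq)
  qed auto
  also have "\<dots> = (\<Sum>i. hcost t (U i)) + (\<Sum>i. ennreal (?slack i))"
    by (intro suminf_add[symmetric]) auto
  also have "(\<Sum>i. ennreal (?slack i)) = ennreal e"
    using e by (intro suminf_ennreal_halves) simp
  finally show ?thesis using that[of V d] V(1-4) by blast
qed

lemma compact_hausdorff_null_coverE:
  fixes E :: "'a::metric_space set"
  assumes E: "compact E" "hausdorff_measure t E = 0" and t: "0 < t" and e: "0 < e"
  obtains I :: "nat set" and V d where "finite I" "E \<subseteq> (\<Union>i\<in>I. V i)" "\<And>i. 0 < d i"
    "\<And>i x y. x \<in> V i \<Longrightarrow> y \<in> V i \<Longrightarrow> dist x y \<le> d i" "(\<Sum>i\<in>I. d i powr t) < e"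
proof -
  have "hausdorff_pre t 1 E < ennreal (e / 2)"
    using E(2) e by (simp add: hausdorff_measure_eq_0_iff)
  then obtain U where U: "E \<subseteq> (\<Union>i. U i)" "\<And>i. bounded (U i)"
    "(\<Sum>i. hcost t (U i)) < ennreal (e / 2)"
    by (rule hausdorff_pre_lessE) blast
  have "0 < e / 2" using e by simp
  obtain V d where V: "\<And>i. open (V i)" "\<And>i. U i \<subseteq> V i" "\<And>i. 0 < d i"
    "\<And>i x y. x \<in> V i \<Longrightarrow> y \<in> V i \<Longrightarrow> dist x y \<le> d i"
    and cost: "(\<Sum>i. ennreal (d i powr t)) \<le> (\<Sum>i. hcost t (U i)) + ennreal (e / 2)"
    by (rule ex_open_cover_suminf_powr_le[of U, OF U(2) t \<open>0 < e / 2\<close>]) blast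
  have "E \<subseteq> (\<Union>i\<in>UNIV. V i)" using U(1) V(2) by blast
  then obtain I where I: "finite I" "E \<subseteq> (\<Union>i\<in>I. V i)"
    using compactE_image[OF E(1), of UNIV V] V(1) by metis
  have "ennreal (\<Sum>i\<in>I. d i powr t) = (\<Sum>i\<in>I. ennreal (d i powr t))" by simp
  also have "\<dots> \<le> (\<Sum>i. ennreal (d i powr t))" by (rule sum_le_suminf) (use I in auto)
  also have "\<dots> \<le> ennreal (e / 2) + (\<Sum>i. hcost t (U i))" using cost by (simp only: add.commute)
  also have "\<dots> < ennreal (e / 2) + ennreal (e / 2)"
    using U(3) by (simp add: ennreal_add_left_cancel_less)
  also have "\<dots> = ennreal e" using e by (simp flip: ennreal_plus)
  finally have "(\<Sum>i\<in>I. d i powr t) < e" by (simp add: ennreal_less_iff sum_nonneg)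
  then show ?thesis using that[of I V d] I V(3,4) by blast
qed

lemma mass_distribution_principle:
  fixes E :: "'a::metric_space set"
  assumes E: "compact E" and t: "0 < t" and C: "0 < C"
    and mass: "\<And>\<delta>. 0 < \<delta> \<Longrightarrow> \<exists>(G :: 'b set) p. finite G \<and> G \<noteq> {} \<and> p ` G \<subseteq> E \<and>
      (\<forall>d V. \<delta> \<le> d \<longrightarrow> d \<le> 1 \<longrightarrow> (\<forall>x\<in>V. \<forall>y\<in>V. dist x y \<le> d) \<longrightarrow>
        real (card {g \<in> G. p g \<in> V}) \<le> C * d powr t * real (card G))"
  shows "hausdorff_measure t E \<noteq> 0"
proof
  assume null: "hausdorff_measure t E = 0"
  define e where "e = min 1 (1 / C)"
  have e: "0 < e" "e * C \<le> 1" using C by (auto simp: e_def min_def field_simps)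
  obtain I :: "nat set" and V d where I: "finite I" "E \<subseteq> (\<Union>i\<in>I. V i)"
    and d: "\<And>i. 0 < d i" and V: "\<And>i x y. x \<in> V i \<Longrightarrow> y \<in> V i \<Longrightarrow> dist x y \<le> d i"
    and cost: "(\<Sum>i\<in>I. d i powr t) < e"
    by (rule compact_hausdorff_null_coverE[OF E null t e(1)]) blast
  define \<delta> where "\<delta> = Min (insert 1 (d ` I))"
  have "0 < \<delta>" using I(1) d by (simp add: \<delta>_def)
  then obtain G :: "'b set" and p where G: "finite G" "G \<noteq> {}" "p ` G \<subseteq> E" and
    mass_le: "\<And>d V. \<delta> \<le> d \<Longrightarrow> d \<le> 1 \<Longrightarrow> \<forall>x\<in>V. \<forall>y\<in>V. dist x y \<le> d \<Longrightarrow>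
        real (card {g \<in> G. p g \<in> V}) \<le> C * d powr t * real (card G)"
    using mass by meson
  have d_le_1: "d i \<le> 1" if "i \<in> I" for i
  proof -
    have "d i powr t \<le> (\<Sum>i\<in>I. d i powr t)" using I(1) that by (intro member_le_sum) auto
    then have "d i powr t < 1" using cost by (simp add: e_def)
    then show ?thesis using t ge_one_powr_ge_zero[of "d i" t] by force
  qed
  have "G = (\<Union>i\<in>I. {g \<in> G. p g \<in> V i})" using G(3) I(2) by blast
  then have "card G \<le> (\<Sum>i\<in>I. card {g \<in> G. p g \<in> V i})"
    using card_UN_le[OF I(1), of "\<lambda>i. {g \<in> G. p g \<in> V i}"] by simp
  then have "real (card G) \<le> (\<Sum>i\<in>I. real (card {g \<in> G. p g \<in> V i}))"
    by (metis of_nat_le_iff of_nat_sum)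
  also have "\<dots> \<le> (\<Sum>i\<in>I. C * d i powr t * real (card G))"
    using I(1) V d_le_1 by (intro sum_mono mass_le) (auto simp: \<delta>_def)
  also have "\<dots> = C * real (card G) * (\<Sum>i\<in>I. d i powr t)"
    unfolding sum_distrib_left by (intro sum.cong) auto
  also have "\<dots> < C * real (card G) * e"
    using C G cost by (intro mult_strict_left_mono) (auto simp: card_gt_0_iff)
  also have "\<dots> \<le> real (card G)"
    using mult_right_mono[OF e(2), of "real (card G)"] by (simp add: mult_ac)
  finally show False by simp
qed

section \<open>Derivatives in normal families\<close>

lemma norm_higher_deriv_diff_le:
  assumes A: "open A" "cball z \<epsilon> \<subseteq> A" "0 < \<epsilon>" and fg: "f holomorphic_on A" "g holomorphic_on A"
    and B: "\<And>w. w \<in> cball z \<epsilon> \<Longrightarrow> norm (f w - g w) \<le> B"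
  shows "norm ((deriv ^^ i) f z - (deriv ^^ i) g z) \<le> fact i * B / \<epsilon> ^ i"
proof -
  have hol: "(\<lambda>w. f w - g w) holomorphic_on A" by (intro holomorphic_on_diff fg)
  have "norm ((deriv ^^ i) (\<lambda>w. f w - g w) z) \<le> fact i * B / \<epsilon> ^ i"
  proof (rule Cauchy_inequality[OF _ _ A(3)])
    show "(\<lambda>w. f w - g w) holomorphic_on ball z \<epsilon>"
      using hol A(2) ball_subset_cball by (meson holomorphic_on_subset order_trans)
    show "continuous_on (cball z \<epsilon>) (\<lambda>w. f w - g w)"
      using holomorphic_on_imp_continuous_on[OF hol] A(2) by (rule continuous_on_subset)
    show "norm (f w - g w) \<le> B" if "norm (z - w) = \<epsilon>" for w
      using that by (intro B) (simp add: dist_norm)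
  qed
  moreover have "z \<in> A" using A(2,3) by auto
  ultimately show ?thesis using higher_deriv_diff[OF fg A(1)] by simp
qed

lemma higher_deriv_tendsto_moving_point:
  assumes A: "open A" "l \<in> A" and f: "\<And>n. f n holomorphic_on A" and g: "g holomorphic_on A"
    and lim: "\<And>K. compact K \<Longrightarrow> K \<subseteq> A \<Longrightarrow> uniform_limit K f g sequentially"
    and \<zeta>: "\<zeta> \<longlonglongrightarrow> l"
  shows "(\<lambda>n. (deriv ^^ i) (f n) (\<zeta> n)) \<longlonglongrightarrow> (deriv ^^ i) g l"
proof -
  obtain r where "0 < r" and r: "cball l r \<subseteq> A"
    using A by (meson open_contains_cball)
  define \<epsilon> where "\<epsilon> = r / 2"
  have \<epsilon>: "0 < \<epsilon>" using \<open>0 < r\<close> by (simp add: \<epsilon>_def)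
  have "(\<lambda>n. (deriv ^^ i) (f n) (\<zeta> n) - (deriv ^^ i) g (\<zeta> n)) \<longlonglongrightarrow> 0"
  proof (rule tendstoI)
    fix e :: real assume "0 < e"
    define B where "B = e * \<epsilon> ^ i / (2 * fact i)"
    have "0 < B" using \<open>0 < e\<close> \<epsilon> by (simp add: B_def)
    then have "\<forall>\<^sub>F n in sequentially. \<forall>w\<in>cball l r. dist (f n w) (g w) < B"
      by (intro uniform_limitD lim r) auto
    moreover have "\<forall>\<^sub>F n in sequentially. dist (\<zeta> n) l < \<epsilon>" by (rule tendstoD[OF \<zeta> \<epsilon>])
    ultimately show "\<forall>\<^sub>F n in sequentially.
        dist ((deriv ^^ i) (f n) (\<zeta> n) - (deriv ^^ i) g (\<zeta> n)) 0 < e"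
    proof eventually_elim
      case (elim n)
      have "dist l w \<le> r" if "dist (\<zeta> n) w \<le> \<epsilon>" for w
        using elim(2) that dist_triangle[of l w "\<zeta> n"] by (simp add: dist_commute \<epsilon>_def)
      then have near: "cball (\<zeta> n) \<epsilon> \<subseteq> cball l r" by auto
      have "norm (f n w - g w) \<le> B" if "w \<in> cball (\<zeta> n) \<epsilon>" for w
        using elim(1) near that by (force simp: dist_norm)
      then have "norm ((deriv ^^ i) (f n) (\<zeta> n) - (deriv ^^ i) g (\<zeta> n)) \<le> fact i * B / \<epsilon> ^ i"
        using near r by (intro norm_higher_deriv_diff_le[OF A(1) _ \<epsilon> f g]) auto
      also have "\<dots> < e" using \<open>0 < e\<close> \<epsilon> by (simp add: B_def)
      finally show ?case by simp
    qed
  qed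
  moreover have "(\<lambda>n. (deriv ^^ i) g (\<zeta> n)) \<longlonglongrightarrow> (deriv ^^ i) g l"
  proof (rule isCont_tendsto_compose[OF _ \<zeta>])
    have "continuous_on A ((deriv ^^ i) g)"
      by (intro holomorphic_on_imp_continuous_on holomorphic_higher_deriv g A)
    then show "isCont ((deriv ^^ i) g) l" using A by (simp add: continuous_on_eq_continuous_at)
  qed
  ultimately show ?thesis using tendsto_add by fastforce
qed

lemma Montel_moving_points:
  fixes \<F> :: "(complex \<Rightarrow> complex) set"
  assumes S: "open S" and hol: "\<And>f. f \<in> \<F> \<Longrightarrow> f holomorphic_on S"
    and loc_bounded: "\<And>K. compact K \<Longrightarrow> K \<subseteq> S \<Longrightarrow> \<exists>B. \<forall>f\<in>\<F>. \<forall>z\<in>K. norm (f z) \<le> B"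
    and K: "compact K" "K \<subseteq> S" and f: "\<And>n. f n \<in> \<F>" and z: "\<And>n. z n \<in> K"
  obtains g l and r :: "nat \<Rightarrow> nat" where "g holomorphic_on S" "l \<in> K" "strict_mono r"
    "\<And>x. x \<in> S \<Longrightarrow> (\<lambda>n. f (r n) x) \<longlonglongrightarrow> g x"
    "\<And>i. (\<lambda>n. (deriv ^^ i) (f (r n)) (z (r n))) \<longlonglongrightarrow> (deriv ^^ i) g l"
proof -
  obtain g r where g: "g holomorphic_on S" and r: "strict_mono r"
    and pointwise: "\<And>x. x \<in> S \<Longrightarrow> (\<lambda>n. f (r n) x) \<longlonglongrightarrow> g x"
    and uniform: "\<And>K. compact K \<Longrightarrow> K \<subseteq> S \<Longrightarrow> uniform_limit K (f \<circ> r) g sequentially"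
    using Montel[OF S hol loc_bounded, of f] f by blast
  have "\<forall>n. (z \<circ> r) n \<in> K" using z by simp
  then obtain l r' where l: "l \<in> K" and r': "strict_mono r'" and "(z \<circ> r \<circ> r') \<longlonglongrightarrow> l"
    using K(1) unfolding compact_def by meson
  then have lim: "(\<lambda>n. z (r (r' n))) \<longlonglongrightarrow> l" by (simp add: o_def)
  show ?thesis
  proof (rule that[OF g l, of "r \<circ> r'"])
    show "strict_mono (r \<circ> r')" by (rule strict_mono_o[OF r r'])
    show "(\<lambda>n. f ((r \<circ> r') n) x) \<longlonglongrightarrow> g x" if "x \<in> S" for x
      using LIMSEQ_subseq_LIMSEQ[OF pointwise[OF that] r'] by (simp add: o_def)
    have "uniform_limit K' (\<lambda>n. f (r (r' n))) g sequentially" if "compact K'" "K' \<subseteq> S" for K'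
      using filterlim_compose[OF uniform[OF that] filterlim_subseq[OF r']] by (simp add: o_def)
    then show "(\<lambda>n. (deriv ^^ i) (f ((r \<circ> r') n)) (z ((r \<circ> r') n))) \<longlonglongrightarrow> (deriv ^^ i) g l" for i
      unfolding o_apply using K l f hol
      by (intro higher_deriv_tendsto_moving_point[OF S _ _ g _ lim]) auto
  qed
qed

lemma normal_family_order_bounded:
  fixes \<F> :: "(complex \<Rightarrow> complex) set"
  assumes S: "open S" "connected S" and hol: "\<And>f. f \<in> \<F> \<Longrightarrow> f holomorphic_on S"
    and loc_bounded: "\<And>K. compact K \<Longrightarrow> K \<subseteq> S \<Longrightarrow> \<exists>B. \<forall>f\<in>\<F>. \<forall>z\<in>K. norm (f z) \<le> B"
    and K: "compact K" "K \<subseteq> S" and \<xi>: "\<xi> \<in> S"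
    and m: "0 < m" "\<And>f. f \<in> \<F> \<Longrightarrow> m \<le> norm (f \<xi>)"
  obtains J c where "0 < c" "\<And>f z. f \<in> \<F> \<Longrightarrow> z \<in> K \<Longrightarrow> \<exists>i\<le>J. c \<le> norm ((deriv ^^ i) f z)"
proof -
  have "\<exists>n. \<forall>f\<in>\<F>. \<forall>z\<in>K. \<exists>i\<le>n. inverse (real (Suc n)) \<le> norm ((deriv ^^ i) f z)"
  proof (rule ccontr)
    assume "\<not> ?thesis"
    then have "\<forall>n. \<exists>f z. f \<in> \<F> \<and> z \<in> K \<and> (\<forall>i\<le>n. norm ((deriv ^^ i) f z) < inverse (real (Suc n)))"
      by (meson not_le)
    then obtain f z where f: "\<And>n. f n \<in> \<F>" and z: "\<And>n. z n \<in> K"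
      and small: "\<And>n i. i \<le> n \<Longrightarrow> norm ((deriv ^^ i) (f n) (z n)) < inverse (real (Suc n))"
      by metis
    obtain g l r where g: "g holomorphic_on S" "l \<in> K" and r: "strict_mono r"
      and pointwise: "\<And>x. x \<in> S \<Longrightarrow> (\<lambda>n. f (r n) x) \<longlonglongrightarrow> g x"
      and derivs: "\<And>i. (\<lambda>n. (deriv ^^ i) (f (r n)) (z (r n))) \<longlonglongrightarrow> (deriv ^^ i) g l"
      by (rule Montel_moving_points[where f = f and z = z, OF S(1) hol loc_bounded K f z])
         (assumption | rule that)+
    have "(\<lambda>n. (deriv ^^ i) (f (r n)) (z (r n))) \<longlonglongrightarrow> 0" for i
    proof (rule Lim_null_comparison[OF _ LIMSEQ_inverse_real_of_nat])
      have "norm ((deriv ^^ i) (f (r n)) (z (r n))) \<le> inverse (real (Suc n))" if "i \<le> n" for n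
      proof -
        have "norm ((deriv ^^ i) (f (r n)) (z (r n))) < inverse (real (Suc (r n)))"
          using that seq_suble[OF r, of n] by (intro small) simp
        also have "\<dots> \<le> inverse (real (Suc n))"
          using seq_suble[OF r, of n] by (intro le_imp_inverse_le) auto
        finally show ?thesis by simp
      qed
      then show "\<forall>\<^sub>F n in sequentially.
          norm ((deriv ^^ i) (f (r n)) (z (r n))) \<le> inverse (real (Suc n))"
        unfolding eventually_sequentially by blast
    qed
    then have "(deriv ^^ i) g l = 0" for i using LIMSEQ_unique[OF derivs] by blast
    then have "g \<xi> = 0"
      using holomorphic_fun_eq_0_on_connected[OF g(1) S] g(2) K(2) \<xi> by blast
    moreover have "m \<le> norm (g \<xi>)"
      using tendsto_norm[OF pointwise[OF \<xi>]] m(2) f by (intro LIMSEQ_le_const) auto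
    ultimately show False using m(1) by simp
  qed
  then obtain n where "\<And>f z. f \<in> \<F> \<Longrightarrow> z \<in> K \<Longrightarrow> \<exists>i\<le>n. inverse (real (Suc n)) \<le> norm ((deriv ^^ i) f z)"
    by blast
  then show ?thesis by (intro that[of "inverse (real (Suc n))" n]) auto
qed

lemma deriv_lower_bound_separates:
  fixes f f' f'' :: "complex \<Rightarrow> complex"
  assumes S: "convex S" "z \<in> S" "w \<in> S"
    and deriv: "\<And>x. x \<in> S \<Longrightarrow> (f has_field_derivative f' x) (at x within S)"
      "\<And>x. x \<in> S \<Longrightarrow> (f' has_field_derivative f'' x) (at x within S)"
    and B: "\<And>x. x \<in> S \<Longrightarrow> norm (f'' x) \<le> B"
    and small: "norm (f z) \<le> \<rho>" "norm (f w) \<le> \<rho>" and large: "\<tau> \<le> norm (f' z)"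
    and near: "2 * B * norm (w - z) \<le> \<tau>"
  shows "\<tau> * norm (w - z) \<le> 4 * \<rho>"
proof -
  let ?x = "norm (w - z)"
  define F where "F i = (if i = 0 then f else if i = 1 then f' else f'')" for i :: nat
  have "(F i has_field_derivative F (Suc i) x) (at x within S)" if "x \<in> S" "i \<le> 1" for i x
    using that deriv by (auto simp: F_def le_Suc_eq)
  then have "norm (F 0 w - (\<Sum>i\<le>1. F i z * (w - z) ^ i / fact i)) \<le> B * ?x ^ Suc 1 / fact 1"
    using S B by (intro complex_Taylor[of S 1 F]) (auto simp: F_def)
  then have "norm (f w - (f z + f' z * (w - z))) \<le> B * ?x ^ 2"
    by (simp add: F_def power2_eq_square)
  moreover have "2 * (B * ?x ^ 2) \<le> \<tau> * ?x"
    using mult_right_mono[OF near, of ?x] by (simp add: power2_eq_square)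
  moreover have "\<tau> * ?x \<le> norm (f' z * (w - z))"
    using large by (simp add: norm_mult mult_right_mono)
  moreover have "norm (f' z * (w - z))
      \<le> norm (f w - (f z + f' z * (w - z))) + norm (f w) + norm (f z)"
    by norm
  ultimately show ?thesis using small by linarith
qed

definition geometrically_bounded :: "real \<Rightarrow> (complex \<Rightarrow> complex) \<Rightarrow> bool" where
  "geometrically_bounded M f \<longleftrightarrow>
     f holomorphic_on ball 0 1 \<and> (\<forall>z\<in>ball 0 1. norm (f z) \<le> M / (1 - norm z))"

lemma geometrically_bounded_nonneg: "geometrically_bounded M f \<Longrightarrow> 0 \<le> M"
  unfolding geometrically_bounded_def
  by (metis centre_in_ball diff_zero div_by_1 norm_ge_zero norm_zero order_trans zero_less_one)

lemma norm_le_geometrically_bounded: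
  assumes f: "geometrically_bounded M f" and z: "norm z \<le> r" and r: "r < 1"
  shows "norm (f z) \<le> M / (1 - r)"
proof -
  have "norm (f z) \<le> M / (1 - norm z)"
    using f z r by (auto simp: geometrically_bounded_def)
  also have "\<dots> \<le> M / (1 - r)"
    using geometrically_bounded_nonneg[OF f] z r by (intro divide_left_mono) auto
  finally show ?thesis .
qed

lemma norm_higher_deriv_power_mult_le:
  assumes f: "geometrically_bounded M f" and z: "norm z \<le> R" and r: "0 < r" "R + r < 1"
  shows "norm ((deriv ^^ i) (\<lambda>w. w ^ k * f w) z)
    \<le> fact i * ((R + r) ^ k * (M / (1 - (R + r)))) / r ^ i"
proof (rule Cauchy_inequality[OF _ _ r(1)])
  have hol: "(\<lambda>w. w ^ k * f w) holomorphic_on ball 0 1"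
    using f unfolding geometrically_bounded_def by (intro holomorphic_intros) auto
  have norm_le: "norm w \<le> R + r" if "norm (z - w) \<le> r" for w
    using that z norm_triangle_ineq2[of w z] by (simp add: norm_minus_commute)
  then have sub: "cball z r \<subseteq> ball 0 1" using r by (force simp: dist_norm)
  then show "(\<lambda>w. w ^ k * f w) holomorphic_on ball z r"
    using ball_subset_cball hol holomorphic_on_subset by blast
  show "continuous_on (cball z r) (\<lambda>w. w ^ k * f w)"
    using continuous_on_subset[OF holomorphic_on_imp_continuous_on[OF hol] sub] .
  have "0 \<le> R + r" using norm_ge_zero[of z] z r(1) by linarith
  moreover fix w assume "norm (z - w) = r"
  ultimately show "norm (w ^ k * f w) \<le> (R + r) ^ k * (M / (1 - (R + r)))"
    unfolding norm_mult norm_power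
    using norm_le[of w] norm_le_geometrically_bounded[OF f _ r(2)]
    by (intro mult_mono power_mono) auto
qed

lemma higher_deriv_power_mult_eventually_le:
  assumes R: "0 \<le> R" "R < S" "R < 1" and e: "0 < e"
  shows "\<forall>\<^sub>F k in sequentially. \<forall>f z. geometrically_bounded M f \<longrightarrow> norm z \<le> R \<longrightarrow>
    norm ((deriv ^^ i) (\<lambda>w. w ^ k * f w) z) \<le> e * S ^ k"
proof -
  define r where "r = (min S 1 - R) / 2"
  have r: "0 < r" "R + r < 1" "R + r < S" using R by (auto simp: r_def min_def field_simps)
  define C where "C = fact i * (M / (1 - (R + r))) / r ^ i"
  have "(\<lambda>k. C * ((R + r) / S) ^ k) \<longlonglongrightarrow> C * 0"
    using r R by (intro tendsto_mult_left LIMSEQ_power_zero) auto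
  then have "\<forall>\<^sub>F k in sequentially. C * ((R + r) / S) ^ k < e"
    using e by (intro order_tendstoD) auto
  then show ?thesis
  proof (eventually_elim, intro allI impI)
    fix k f and z :: complex
    assume small: "C * ((R + r) / S) ^ k < e" and fz: "geometrically_bounded M f" "norm z \<le> R"
    have "norm ((deriv ^^ i) (\<lambda>w. w ^ k * f w) z) \<le> C * (R + r) ^ k"
      using norm_higher_deriv_power_mult_le[OF fz r(1,2), of i k] by (simp add: C_def mult_ac)
    also have "\<dots> = C * ((R + r) / S) ^ k * S ^ k" using R by (simp add: power_divide)
    also have "\<dots> \<le> e * S ^ k" using small R by (intro mult_right_mono) auto
    finally show "norm ((deriv ^^ i) (\<lambda>w. w ^ k * f w) z) \<le> e * S ^ k" .
  qed
qed

lemma geometrically_bounded_order_bounded: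
  assumes R: "R < 1" and m: "0 < m"
  obtains J c where "0 < c" "\<And>f z. geometrically_bounded M f \<Longrightarrow> m \<le> norm (f 0) \<Longrightarrow> norm z \<le> R \<Longrightarrow>
    \<exists>i\<le>J. c \<le> norm ((deriv ^^ i) f z)"
proof -
  let ?F = "{f. geometrically_bounded M f \<and> m \<le> norm (f 0)}"
  have loc_bounded: "\<exists>B. \<forall>f\<in>?F. \<forall>z\<in>K. norm (f z) \<le> B" if K: "compact K" "K \<subseteq> ball 0 1" for K
  proof (cases "K = {}")
    case False
    then obtain x where x: "x \<in> K" "\<And>z. z \<in> K \<Longrightarrow> norm z \<le> norm x"
      using continuous_attains_sup[OF K(1), of norm] by (auto intro: continuous_intros)
    moreover have "norm x < 1" using x(1) K(2) by auto
    ultimately show ?thesis using norm_le_geometrically_bounded by blast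
  qed auto
  obtain J c where "0 < c" and
    "\<And>f z. f \<in> ?F \<Longrightarrow> z \<in> cball 0 R \<Longrightarrow> \<exists>i\<le>J. c \<le> norm ((deriv ^^ i) f z)"
    by (rule normal_family_order_bounded[of "ball 0 1" ?F "cball 0 R" 0 m])
       (use R m loc_bounded in \<open>auto simp: geometrically_bounded_def\<close>)
  then show ?thesis by (intro that) auto
qed

lemma higher_deriv_separates:
  assumes R: "R < 1"
  obtains c where "0 < c"
    "\<And>f z w \<rho> \<tau>. geometrically_bounded M f \<Longrightarrow> norm z \<le> R \<Longrightarrow> norm w \<le> R \<Longrightarrow>
      norm ((deriv ^^ i) f z) \<le> \<rho> \<Longrightarrow> norm ((deriv ^^ i) f w) \<le> \<rho> \<Longrightarrow>
      \<tau> \<le> norm ((deriv ^^ Suc i) f z) \<Longrightarrow> norm (w - z) \<le> c * \<tau> \<Longrightarrow> \<tau> * norm (w - z) \<le> 4 * \<rho>"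
proof -
  define r where "r = (1 - R) / 2"
  define B where "B = max 1 (fact (i + 2) * (M / (1 - (R + r))) / r ^ (i + 2))"
  have r: "0 < r" "R + r < 1" using R by (auto simp: r_def field_simps)
  have "\<tau> * norm (w - z) \<le> 4 * \<rho>"
    if f: "geometrically_bounded M f" and zw: "norm z \<le> R" "norm w \<le> R"
      and small: "norm ((deriv ^^ i) f z) \<le> \<rho>" "norm ((deriv ^^ i) f w) \<le> \<rho>"
      and large: "\<tau> \<le> norm ((deriv ^^ Suc i) f z)" and near: "norm (w - z) \<le> 1 / (2 * B) * \<tau>"
    for f z w \<rho> \<tau>
  proof (rule deriv_lower_bound_separates[of "cball 0 R" z w])
    have hol: "(deriv ^^ j) f holomorphic_on ball 0 1" for j
      using f by (auto simp: geometrically_bounded_def intro: holomorphic_higher_deriv)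
    have "((deriv ^^ j) f has_field_derivative (deriv ^^ Suc j) f x) (at x within cball 0 R)"
      if "x \<in> cball 0 R" for x j
      using that R holomorphic_derivI[OF hol] by simp
    then show
      "x \<in> cball 0 R \<Longrightarrow>
        ((deriv ^^ i) f has_field_derivative (deriv ^^ Suc i) f x) (at x within cball 0 R)"
      "x \<in> cball 0 R \<Longrightarrow>
        ((deriv ^^ Suc i) f has_field_derivative (deriv ^^ Suc (Suc i)) f x) (at x within cball 0 R)"
      for x by blast+
    show "norm ((deriv ^^ Suc (Suc i)) f x) \<le> B" if "x \<in> cball 0 R" for x
      using norm_higher_deriv_power_mult_le[OF f _ r, of x "i + 2" 0] that
      by (simp add: B_def del: fact_Suc)
    have "0 < B" by (simp add: B_def)
    then show "2 * B * norm (w - z) \<le> \<tau>" using near by (simp add: field_simps)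
  qed (use zw small large in auto)
  moreover have "0 < 1 / (2 * B)" by (simp add: B_def)
  ultimately show ?thesis using that by blast
qed

section \<open>Counting close and separated points\<close>

lemma card_shifted_coincidences_eq_sum:
  fixes g :: "'a \<Rightarrow> 'b"
  assumes "finite S"
  shows "card {(u, v) \<in> S \<times> S. \<phi> (g u) = g v}
    = (\<Sum>c\<in>g ` S. card {u \<in> S. g u = c} * card {v \<in> S. g v = \<phi> c})"
proof -
  have "{(u, v) \<in> S \<times> S. \<phi> (g u) = g v} = (\<Union>c\<in>g ` S. {u \<in> S. g u = c} \<times> {v \<in> S. g v = \<phi> c})"
    by auto
  also have "card \<dots> = (\<Sum>c\<in>g ` S. card ({u \<in> S. g u = c} \<times> {v \<in> S. g v = \<phi> c}))"
    using assms by (intro card_UN_disjoint) auto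
  finally show ?thesis by (simp add: card_cartesian_product)
qed

lemma card_shifted_coincidences_le:
  fixes g :: "'a \<Rightarrow> 'b"
  assumes S: "finite S" and \<phi>: "inj \<phi>"
  shows "card {(u, v) \<in> S \<times> S. \<phi> (g u) = g v} \<le> card {(u, v) \<in> S \<times> S. g u = g v}"
proof -
  define n where "n c = real (card {u \<in> S. g u = c})" for c
  have n_zero: "n c = 0" if "c \<notin> g ` S" for c
    using that by (auto simp: n_def card_eq_0_iff)
  have "(\<Sum>c\<in>g ` S. n (\<phi> c) ^ 2) = (\<Sum>c\<in>\<phi> ` g ` S. n c ^ 2)"
    using sum.reindex[OF inj_on_subset[OF \<phi> subset_UNIV], of "\<lambda>c. n c ^ 2" "g ` S"]
    by (simp add: o_def)
  also have "\<dots> = (\<Sum>c\<in>(\<phi> ` g ` S) \<inter> (g ` S). n c ^ 2)"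
    using S by (intro sum.mono_neutral_right) (auto simp: n_zero)
  also have "\<dots> \<le> (\<Sum>c\<in>g ` S. n c ^ 2)"
    using S by (intro sum_mono2) auto
  finally have shifted_le: "(\<Sum>c\<in>g ` S. n (\<phi> c) ^ 2) \<le> (\<Sum>c\<in>g ` S. n c ^ 2)" .
  have "2 * (\<Sum>c\<in>g ` S. n c * n (\<phi> c)) \<le> (\<Sum>c\<in>g ` S. n c ^ 2 + n (\<phi> c) ^ 2)"
    unfolding sum_distrib_left mult.assoc[symmetric] by (rule sum_mono) (rule sum_squares_bound)
  also have "\<dots> \<le> 2 * (\<Sum>c\<in>g ` S. n c * n (id c))"
    using shifted_le by (simp add: sum.distrib power2_eq_square)
  finally have "real (card {(u, v) \<in> S \<times> S. \<phi> (g u) = g v})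
      \<le> real (card {(u, v) \<in> S \<times> S. id (g u) = g v})"
    unfolding card_shifted_coincidences_eq_sum[OF S] n_def by simp
  then show ?thesis by simp
qed

definition cell :: "real \<Rightarrow> complex \<Rightarrow> int \<times> int" where
  "cell \<rho> z = (\<lfloor>2 * Re z / \<rho>\<rfloor>, \<lfloor>2 * Im z / \<rho>\<rfloor>)"

lemma cell_eq_imp_close:
  assumes "cell \<rho> z = cell \<rho> w" "0 < \<rho>" shows "norm (z - w) \<le> \<rho>"
proof -
  have coord: "\<bar>x - y\<bar> \<le> \<rho> / 2" if "\<lfloor>2 * x / \<rho>\<rfloor> = \<lfloor>2 * y / \<rho>\<rfloor>" for x y :: real
  proof -
    have "\<bar>2 * x / \<rho> - 2 * y / \<rho>\<bar> \<le> 1" using that by linarith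
    then have "x \<le> y + \<rho> / 2" "y \<le> x + \<rho> / 2"
      using assms(2) by (auto simp: abs_le_iff field_simps)
    then show ?thesis by linarith
  qed
  have "norm (z - w) \<le> \<bar>Re (z - w)\<bar> + \<bar>Im (z - w)\<bar>" by (rule cmod_le)
  also have "\<dots> \<le> \<rho> / 2 + \<rho> / 2"
    using assms(1) coord[of "Re z" "Re w"] coord[of "Im z" "Im w"]
    by (intro add_mono) (auto simp: cell_def)
  finally show ?thesis by simp
qed

lemma floor_diff_bounds:
  fixes a b y :: real
  assumes "\<bar>y + a - b\<bar> \<le> 2"
  shows "\<lfloor>b\<rfloor> - \<lfloor>a\<rfloor> \<in> {\<lfloor>y\<rfloor> - 2..\<lfloor>y\<rfloor> + 3}"
proof -
  have "a + y - 2 \<le> b" "b \<le> a + y + 2" using assms by linarith+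
  then have "\<lfloor>a + y - 2\<rfloor> \<le> \<lfloor>b\<rfloor>" "\<lfloor>b\<rfloor> \<le> \<lfloor>a + y + 2\<rfloor>" by (simp_all only: floor_mono)
  moreover have "\<lfloor>a + y - 2\<rfloor> = \<lfloor>a + y\<rfloor> - 2" "\<lfloor>a + y + 2\<rfloor> = \<lfloor>a + y\<rfloor> + 2" by linarith+
  moreover have "\<lfloor>a\<rfloor> + \<lfloor>y\<rfloor> \<le> \<lfloor>a + y\<rfloor>" "\<lfloor>a + y\<rfloor> \<le> \<lfloor>a\<rfloor> + \<lfloor>y\<rfloor> + 1" by linarith+
  ultimately show ?thesis by simp
qed

lemma cell_diff_bounds:
  assumes close: "norm (x + z - w) \<le> \<rho>" and \<rho>: "0 < \<rho>"
  shows "cell \<rho> w - cell \<rho> z \<in> {\<lfloor>2 * Re x / \<rho>\<rfloor> - 2..\<lfloor>2 * Re x / \<rho>\<rfloor> + 3}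
    \<times> {\<lfloor>2 * Im x / \<rho>\<rfloor> - 2..\<lfloor>2 * Im x / \<rho>\<rfloor> + 3}"
proof -
  have scaled: "\<bar>2 * s / \<rho> + 2 * t / \<rho> - 2 * r / \<rho>\<bar> \<le> 2" if "\<bar>s + t - r\<bar> \<le> \<rho>" for s t r :: real
  proof -
    have "2 * s / \<rho> + 2 * t / \<rho> - 2 * r / \<rho> = 2 * ((s + t - r) / \<rho>)"
      by (simp add: add_divide_distrib diff_divide_distrib algebra_simps)
    moreover have "\<bar>(s + t - r) / \<rho>\<bar> \<le> 1" using that \<rho> by (simp add: abs_divide)
    ultimately show ?thesis by (simp only: abs_mult)
  qed
  have "\<bar>Re x + Re z - Re w\<bar> \<le> \<rho>" "\<bar>Im x + Im z - Im w\<bar> \<le> \<rho>"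
    using abs_Re_le_cmod[of "x + z - w"] abs_Im_le_cmod[of "x + z - w"] close by auto
  then show ?thesis
    using floor_diff_bounds[OF scaled] by (auto simp: cell_def minus_prod_def)
qed

lemma card_translated_close_le:
  fixes f :: "'a \<Rightarrow> complex"
  assumes S: "finite S" and \<rho>: "0 < \<rho>"
  shows "card {(u, v) \<in> S \<times> S. norm (x + f u - f v) \<le> \<rho>}
     \<le> 36 * card {(u, v) \<in> S \<times> S. norm (f u - f v) \<le> \<rho>}"
proof -
  define q where "q u = cell \<rho> (f u)" for u
  define D where "D = {\<lfloor>2 * Re x / \<rho>\<rfloor> - 2..\<lfloor>2 * Re x / \<rho>\<rfloor> + 3}
    \<times> {\<lfloor>2 * Im x / \<rho>\<rfloor> - 2..\<lfloor>2 * Im x / \<rho>\<rfloor> + 3}"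
  have finite_pairs: "finite {(u, v) \<in> S \<times> S. P u v}" for P
    by (rule finite_subset[of _ "S \<times> S"]) (use S in auto)
  have "{(u, v) \<in> S \<times> S. norm (x + f u - f v) \<le> \<rho>} \<subseteq> (\<Union>d\<in>D. {(u, v) \<in> S \<times> S. q u + d = q v})"
  proof safe
    fix u v assume uv: "u \<in> S" "v \<in> S" and "norm (x + f u - f v) \<le> \<rho>"
    then have "q v - q u \<in> D" unfolding q_def D_def by (intro cell_diff_bounds \<rho>)
    moreover have "q u + (q v - q u) = q v" by simp
    ultimately show "(u, v) \<in> (\<Union>d\<in>D. {(u, v) \<in> S \<times> S. q u + d = q v})" using uv by blast
  qed
  then have "card {(u, v) \<in> S \<times> S. norm (x + f u - f v) \<le> \<rho>}
      \<le> card (\<Union>d\<in>D. {(u, v) \<in> S \<times> S. q u + d = q v})"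
    by (intro card_mono finite_UN_I finite_pairs) (auto simp: D_def)
  also have "\<dots> \<le> (\<Sum>d\<in>D. card {(u, v) \<in> S \<times> S. q u + d = q v})"
    by (rule card_UN_le) (simp add: D_def)
  also have "\<dots> \<le> (\<Sum>d\<in>D. card {(u, v) \<in> S \<times> S. q u = q v})"
    by (intro sum_mono card_shifted_coincidences_le[OF S]) (simp add: inj_def)
  also have "\<dots> = 36 * card {(u, v) \<in> S \<times> S. q u = q v}"
    by (simp add: D_def card_cartesian_product)
  also have "\<dots> \<le> 36 * card {(u, v) \<in> S \<times> S. norm (f u - f v) \<le> \<rho>}"
    using cell_eq_imp_close[OF _ \<rho>]
    by (intro mult_left_mono card_mono finite_pairs) (auto simp: q_def)
  finally show ?thesis .
qed

lemma card_separated_le: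
  fixes X :: "complex set"
  assumes X: "X \<subseteq> cball 0 r" "pairwise (\<lambda>x y. \<sigma> < dist x y) X" and \<sigma>: "0 < \<sigma>" "\<sigma> \<le> r"
  shows "real (card X) \<le> 36 * (r / \<sigma>) ^ 2"
proof -
  let ?y = "2 * r / \<sigma>"
  define I where "I = {\<lfloor>- ?y\<rfloor>..\<lfloor>?y\<rfloor>}"
  have y: "2 \<le> ?y" using \<sigma> by (simp add: field_simps)
  have inj: "inj_on (cell \<sigma>) X"
    using X(2) cell_eq_imp_close[OF _ \<sigma>(1)]
    by (intro inj_onI) (force simp: pairwise_def dist_norm)
  have floor_in: "\<lfloor>2 * t / \<sigma>\<rfloor> \<in> I" if "\<bar>t\<bar> \<le> r" for t
  proof -
    have "- ?y \<le> 2 * t / \<sigma>" "2 * t / \<sigma> \<le> ?y"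
      using that \<sigma> by (auto simp: field_simps)
    then show ?thesis unfolding I_def by (auto intro: floor_mono)
  qed
  have "cell \<sigma> x \<in> I \<times> I" if "x \<in> X" for x
    using that X(1) abs_Re_le_cmod[of x] abs_Im_le_cmod[of x]
    by (force simp: cell_def intro: floor_in)
  then have "cell \<sigma> ` X \<subseteq> I \<times> I" by blast
  then have "card X \<le> card (I \<times> I)"
    by (intro card_inj_on_le[OF inj]) (auto simp: I_def)
  then have "real (card X) \<le> real (card I) ^ 2"
    by (simp add: card_cartesian_product power2_eq_square flip: of_nat_mult)
  also have "\<dots> \<le> (3 * ?y) ^ 2"
  proof (rule power_mono)
    have "real (card I) = of_int (\<lfloor>?y\<rfloor> - \<lfloor>- ?y\<rfloor> + 1)"
      using y unfolding I_def card_atLeastAtMost_int by (subst of_nat_nat) linarith+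
    also have "\<dots> \<le> 3 * ?y" using y by linarith
    finally show "real (card I) \<le> 3 * ?y" .
  qed simp
  finally show ?thesis by (simp add: power_divide power_mult_distrib)
qed

lemma ex_net_of_separated_card_le:
  fixes B :: "'a::metric_space set"
  assumes "0 \<le> \<delta>"
    and bound: "\<And>X. finite X \<Longrightarrow> X \<subseteq> B \<Longrightarrow> pairwise (\<lambda>x y. \<delta> < dist x y) X \<Longrightarrow> real (card X) \<le> N"
  obtains X where "finite X" "B \<subseteq> (\<Union>x\<in>X. cball x \<delta>)" "real (card X) \<le> N"
proof -
  define separated where "separated X \<longleftrightarrow> finite X \<and> X \<subseteq> B \<and> pairwise (\<lambda>x y. \<delta> < dist x y) X" for X
  have "\<exists>X. separated X \<and> (\<forall>Y. separated Y \<longrightarrow> card Y \<le> card X)"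
  proof (rule ex_has_greatest_nat)
    show "separated {}" by (simp add: separated_def)
    show "\<forall>Y. separated Y \<longrightarrow> card Y < Suc (nat \<lfloor>N\<rfloor>)"
      using bound by (auto simp: separated_def le_nat_floor less_Suc_eq_le)
  qed
  then obtain X where X: "separated X" and maximal: "\<And>Y. separated Y \<Longrightarrow> card Y \<le> card X" by blast
  have "B \<subseteq> (\<Union>x\<in>X. cball x \<delta>)"
  proof (rule ccontr)
    assume "\<not> ?thesis"
    then obtain z where "z \<in> B" "z \<notin> (\<Union>x\<in>X. cball x \<delta>)" by blast
    then have z: "z \<in> B" "\<And>x. x \<in> X \<Longrightarrow> \<delta> < dist x z" by (auto simp: not_le)
    then have "separated (insert z X)"
      using X by (auto simp: separated_def pairwise_insert dist_commute)
    moreover have "z \<notin> X" using z(2)[of z] \<open>0 \<le> \<delta>\<close> by auto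
    ultimately show False using maximal[of "insert z X"] X by (simp add: separated_def)
  qed
  then show ?thesis using that X bound by (auto simp: separated_def)
qed

lemma mult_card_le_by_multiplicity:
  assumes fin: "finite X" "finite P" and T: "\<And>x. x \<in> X \<Longrightarrow> T x \<subseteq> P"
    and L: "\<And>x. x \<in> X \<Longrightarrow> L \<le> real (card (T x))"
    and N: "\<And>p. p \<in> P \<Longrightarrow> real (card {x \<in> X. p \<in> T x}) \<le> N"
  shows "L * real (card X) \<le> N * real (card P)"
proof -
  have "L * real (card X) = (\<Sum>x\<in>X. L)" by simp
  also have "\<dots> \<le> (\<Sum>x\<in>X. real (card (T x)))" by (intro sum_mono L)
  also have "\<dots> = real (\<Sum>x\<in>X. card {p \<in> P. p \<in> T x})"
    unfolding of_nat_sum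
  proof (rule sum.cong[OF refl])
    fix x assume "x \<in> X"
    then have "{p \<in> P. p \<in> T x} = T x" using T by blast
    then show "real (card (T x)) = real (card {p \<in> P. p \<in> T x})" by simp
  qed
  also have "\<dots> = (\<Sum>p\<in>P. real (card {x \<in> X. p \<in> T x}))"
    by (subst sum_multicount_gen[OF fin, of "\<lambda>x p. p \<in> T x"]) auto
  also have "\<dots> \<le> (\<Sum>p\<in>P. N)" by (intro sum_mono N)
  finally show ?thesis by (simp add: mult.commute)
qed

lemma cover_by_multiplicity:
  fixes B :: "complex set" and T :: "complex \<Rightarrow> 'p set"
  assumes P: "finite P" and B: "B \<subseteq> cball 0 r" and T: "\<And>z. z \<in> B \<Longrightarrow> T z \<subseteq> P"
    and L: "0 < L" "\<And>z. z \<in> B \<Longrightarrow> L \<le> real (card (T z))"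
    and \<sigma>: "0 < \<sigma>" "\<sigma> \<le> r" and \<delta>: "0 \<le> \<delta>"
    and sep: "\<And>p z w. z \<in> B \<Longrightarrow> w \<in> B \<Longrightarrow> p \<in> T z \<Longrightarrow> p \<in> T w \<Longrightarrow> dist z w \<le> \<sigma> \<Longrightarrow> dist z w \<le> \<delta>"
  obtains X where "finite X" "B \<subseteq> (\<Union>x\<in>X. cball x \<delta>)"
    "real (card X) \<le> 36 * (r / \<sigma>) ^ 2 * real (card P) / L"
proof (rule ex_net_of_separated_card_le[OF \<delta>])
  fix X assume X: "finite X" "X \<subseteq> B" "pairwise (\<lambda>x y. \<delta> < dist x y) X"
  have "L * real (card X) \<le> 36 * (r / \<sigma>) ^ 2 * real (card P)"
  proof (rule mult_card_le_by_multiplicity[OF X(1) P])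
    fix p
    have "pairwise (\<lambda>x y. \<sigma> < dist x y) {x \<in> X. p \<in> T x}"
      using X sep unfolding pairwise_def by (smt (verit) mem_Collect_eq subsetD)
    then show "real (card {x \<in> X. p \<in> T x}) \<le> 36 * (r / \<sigma>) ^ 2"
      using X(2) B by (intro card_separated_le[OF _ _ \<sigma>]) auto
  qed (use X(2) T L(2) in blast)+
  then show "real (card X) \<le> 36 * (r / \<sigma>) ^ 2 * real (card P) / L"
    using L(1) by (simp add: pos_le_divide_eq mult.commute)
qed (rule that)

lemma ex_record:
  fixes f :: "nat \<Rightarrow> real"
  assumes "\<And>A. \<exists>m. A < f m"
  obtains m where "m0 \<le> m" "\<And>n. n \<le> m \<Longrightarrow> f n \<le> f m"
proof -
  define A where "A = Max (f ` {..m0})"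
  define m where "m = (LEAST m. A < f m)"
  have exceeds: "A < f m" unfolding m_def using assms[of A] by (rule LeastI_ex)
  have before: "f n \<le> A" if "n < m" for n
    using not_less_Least[of n "\<lambda>m. A < f m"] that by (simp add: m_def not_less)
  have "f n \<le> A" if "n \<le> m0" for n using that by (simp add: A_def)
  then have "m0 \<le> m" using exceeds by (metis linorder_not_le nle_le)
  moreover have "f n \<le> f m" if "n \<le> m" for n
    using before[of n] exceeds that by (cases "n = m") auto
  ultimately show ?thesis by (rule that)
qed

section \<open>Words\<close>

definition words :: "nat \<Rightarrow> int list set" where
  "words m = {w. set w \<subseteq> {-1, 1} \<and> length w = m}"

abbreviation wsum :: "complex \<Rightarrow> int list \<Rightarrow> complex" where
  "wsum z w \<equiv> horner_sum of_int z w"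

lemma finite_words [simp]: "finite (words m)"
  unfolding words_def by (rule finite_lists_length_eq) simp

lemma card_words: "card (words m) = 2 ^ m"
  unfolding words_def by (subst card_lists_length_eq) (auto simp: numeral_2_eq_2)

lemma length_words: "w \<in> words m \<Longrightarrow> length w = m"
  by (simp add: words_def)

lemma take_words: "w \<in> words m \<Longrightarrow> k \<le> m \<Longrightarrow> take k w \<in> words k"
  unfolding words_def by (auto dest: in_set_takeD)

lemma drop_words: "w \<in> words m \<Longrightarrow> drop k w \<in> words (m - k)"
  unfolding words_def by (auto dest: in_set_dropD)

lemma words_SucE:
  assumes "w \<in> words (Suc m)" obtains x v where "w = x # v" "x \<in> {-1, 1}" "v \<in> words m"
  using assms by (auto simp: words_def length_Suc_conv)

lemma wsum_take_drop:
  assumes "w \<in> words m" "k \<le> m" shows "wsum z w = wsum z (take k w) + z ^ k * wsum z (drop k w)"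
  using horner_sum_append[of of_int z "take k w" "drop k w"] assms length_words[OF assms(1)] by simp

lemma card_words_take_in_le:
  assumes "n \<le> M" "B \<subseteq> words n"
  shows "card {u \<in> words M. take n u \<in> B} \<le> card B * 2 ^ (M - n)"
proof -
  have fin: "finite (B \<times> words (M - n))" using finite_subset[OF assms(2)] by auto
  have "{u \<in> words M. take n u \<in> B} \<subseteq> (\<lambda>(u, v). u @ v) ` (B \<times> words (M - n))"
  proof clarify
    fix u assume "u \<in> words M" "take n u \<in> B"
    then show "u \<in> (\<lambda>(u, v). u @ v) ` (B \<times> words (M - n))"
      using drop_words by (intro image_eqI[where x = "(take n u, drop n u)"]) auto
  qed
  then have "card {u \<in> words M. take n u \<in> B} \<le> card ((\<lambda>(u, v). u @ v) ` (B \<times> words (M - n)))"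
    using fin by (intro card_mono) auto
  also have "\<dots> \<le> card (B \<times> words (M - n))" by (rule card_image_le[OF fin])
  finally show ?thesis by (simp add: card_cartesian_product card_words)
qed

lemma card_gt_le_sum_divide:
  fixes f :: "'a \<Rightarrow> real"
  assumes S: "finite S" and f: "\<And>x. x \<in> S \<Longrightarrow> 0 \<le> f x" and c: "0 < c"
  shows "real (card {x \<in> S. c < f x}) \<le> (\<Sum>x\<in>S. f x) / c"
proof -
  have "c * real (card {x \<in> S. c < f x}) = (\<Sum>x\<in>{x \<in> S. c < f x}. c)" by simp
  also have "\<dots> \<le> (\<Sum>x\<in>{x \<in> S. c < f x}. f x)" by (intro sum_mono) auto
  also have "\<dots> \<le> (\<Sum>x\<in>S. f x)" using S f by (intro sum_mono2) auto
  finally show ?thesis using c by (simp add: pos_le_divide_eq mult.commute)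
qed

lemma half_words_avoid_prefixes:
  assumes q: "0 \<le> q" "q < 1"
    and B: "\<And>n. B n \<subseteq> words n" "\<And>n. real (card (B n)) \<le> (1 - q) / 2 * (2 * q) ^ n"
  shows "2 ^ M \<le> 2 * real (card {u \<in> words M. \<forall>n\<le>M. take n u \<notin> B n})"
proof -
  let ?good = "{u \<in> words M. \<forall>n\<le>M. take n u \<notin> B n}" and ?bad = "\<lambda>n. {u \<in> words M. take n u \<in> B n}"
  have bad_le: "real (card (?bad n)) \<le> 2 ^ M * ((1 - q) / 2) * q ^ n" if "n \<le> M" for n
  proof -
    have "real (card (?bad n)) \<le> real (card (B n) * 2 ^ (M - n))"
      using card_words_take_in_le[OF that B(1)] by (simp only: of_nat_le_iff)
    also have "\<dots> \<le> (1 - q) / 2 * (2 * q) ^ n * 2 ^ (M - n)"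
      using B(2)[of n] by (simp add: mult_right_mono)
    also have "\<dots> = (2 ^ n * 2 ^ (M - n)) * ((1 - q) / 2) * q ^ n" by (simp add: power_mult_distrib)
    also have "(2::real) ^ n * 2 ^ (M - n) = 2 ^ M" using that by (simp flip: power_add)
    finally show ?thesis .
  qed
  have "card (words M) \<le> card (?good \<union> (\<Union>n\<le>M. ?bad n))" by (intro card_mono) auto
  also have "\<dots> \<le> card ?good + (\<Sum>n\<le>M. card (?bad n))"
    by (intro order_trans[OF card_Un_le] add_left_mono card_UN_le) simp
  finally have "real (card (words M)) \<le> real (card ?good + (\<Sum>n\<le>M. card (?bad n)))"
    by (simp only: of_nat_le_iff)
  then have "2 ^ M \<le> real (card ?good) + (\<Sum>n\<le>M. real (card (?bad n)))" by (simp add: card_words)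
  also have "\<dots> \<le> real (card ?good) + (\<Sum>n\<le>M. 2 ^ M * ((1 - q) / 2) * q ^ n)"
    by (intro add_left_mono sum_mono bad_le) simp
  also have "(\<Sum>n\<le>M. 2 ^ M * ((1 - q) / 2) * q ^ n) = 2 ^ M / 2 * ((1 - q) * (\<Sum>n\<le>M. q ^ n))"
    by (simp add: sum_distrib_left mult_ac)
  also have "\<dots> = 2 ^ M / 2 * (1 - q ^ Suc M)" by (simp only: sum_gp_basic)
  also have "\<dots> \<le> 2 ^ M / 2 * 1" using q by (intro mult_left_mono) auto
  finally show ?thesis by simp
qed

lemma half_words_prefixes_le:
  fixes f :: "int list \<Rightarrow> real"
  assumes f: "\<And>w. 0 \<le> f w" "\<And>n. (\<Sum>v\<in>words n. f v) \<le> A * (2 * h) ^ n"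
    and A: "0 < A" and h: "0 < h" "h < \<theta>"
  obtains C where "0 < C"
    "\<And>M. 2 ^ M \<le> 2 * real (card {u \<in> words M. \<forall>n\<le>M. f (take n u) \<le> C * \<theta> ^ n})"
proof -
  define q where "q = h / \<theta>"
  have q: "0 < q" "q < 1" using h by (auto simp: q_def)
  define C where "C = 2 * A / (1 - q)"
  have C: "0 < C" using A q by (simp add: C_def)
  define Bad where "Bad n = {v \<in> words n. C * \<theta> ^ n < f v}" for n
  have card_Bad: "real (card (Bad n)) \<le> (1 - q) / 2 * (2 * q) ^ n" for n
  proof -
    have "real (card (Bad n)) \<le> (\<Sum>v\<in>words n. f v) / (C * \<theta> ^ n)"
      unfolding Bad_def using C h by (intro card_gt_le_sum_divide f) auto
    also have "\<dots> \<le> A * (2 * h) ^ n / (C * \<theta> ^ n)"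
      using C h by (intro divide_right_mono f) auto
    also have "\<dots> = (1 - q) / 2 * (2 * q) ^ n"
      using A q h by (simp add: C_def q_def power_divide power_mult_distrib)
    finally show ?thesis .
  qed
  have "{u \<in> words M. \<forall>n\<le>M. take n u \<notin> Bad n} = {u \<in> words M. \<forall>n\<le>M. f (take n u) \<le> C * \<theta> ^ n}" for M
    using take_words by (auto simp: Bad_def not_less)
  moreover have "Bad n \<subseteq> words n" for n by (auto simp: Bad_def)
  ultimately show ?thesis
    using that[OF C] half_words_avoid_prefixes[OF less_imp_le[OF q(1)] q(2) _ card_Bad] by simp
qed

section \<open>The dimension of the attractor\<close>

lemma
  fixes a :: "nat \<Rightarrow> int" and z :: complex
  assumes a: "\<And>n. a n \<in> {-1, 1}" and z: "norm z < 1"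
  shows summable_sign_series: "summable (\<lambda>n. of_int (a n) * z ^ n)"
    and norm_sign_series_le: "norm (\<Sum>n. of_int (a n) * z ^ n) \<le> 1 / (1 - norm z)"
proof -
  have summable_norm: "summable (\<lambda>n. norm z ^ n)" using z by (intro summable_geometric) simp
  have norm_term: "norm (of_int (a n) * z ^ n) \<le> norm z ^ n" for n
    using a[of n] by (auto simp: norm_mult norm_power)
  then show "summable (\<lambda>n. of_int (a n) * z ^ n)"
    by (rule summable_comparison_test'[OF summable_norm])
  have "norm (\<Sum>n. of_int (a n) * z ^ n) \<le> (\<Sum>n. norm z ^ n)"
    by (rule norm_suminf_le[OF norm_term summable_norm])
  then show "norm (\<Sum>n. of_int (a n) * z ^ n) \<le> 1 / (1 - norm z)"
    using z by (simp add: suminf_geometric)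
qed

lemma norm_le_of_mem_A_set:
  assumes "norm z < 1" "x \<in> A_set z" shows "norm x \<le> 1 / (1 - norm z)"
  using assms norm_sign_series_le unfolding A_set_def by blast

lemma A_set_nonempty: "A_set z \<noteq> {}"
proof -
  have "(\<Sum>n. of_int 1 * z ^ n) \<in> A_set z"
    unfolding A_set_def by (intro CollectI exI[of _ "\<lambda>_. 1"]) simp
  then show ?thesis by blast
qed

lemma sign_series_eq_wsum_plus:
  fixes z :: complex
  assumes "\<And>n. a n \<in> {-1, 1::int}" "norm z < 1"
  shows "(\<Sum>n. of_int (a n) * z ^ n)
    = wsum z (map a [0..<k]) + z ^ k * (\<Sum>n. of_int (a (n + k)) * z ^ n)"
proof -
  have "(\<Sum>n. of_int (a n) * z ^ n)
      = (\<Sum>n. of_int (a (n + k)) * z ^ (n + k)) + (\<Sum>n<k. of_int (a n) * z ^ n)"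
    by (rule suminf_split_initial_segment[OF summable_sign_series[OF assms]])
  also have "(\<Sum>n. of_int (a (n + k)) * z ^ (n + k)) = z ^ k * (\<Sum>n. of_int (a (n + k)) * z ^ n)"
    using suminf_mult[OF summable_sign_series[of "\<lambda>n. a (n + k)" z], of "z ^ k"] assms
    by (simp add: power_add mult_ac)
  finally show ?thesis by (simp add: horner_sum_eq_sum atLeast0LessThan)
qed

lemma A_set_eq_UN_words:
  assumes z: "norm z < 1"
  shows "A_set z = (\<Union>u\<in>words k. (\<lambda>x. wsum z u + z ^ k * x) ` A_set z)"
proof (intro equalityI subsetI)
  fix x assume "x \<in> A_set z"
  then obtain a :: "nat \<Rightarrow> int" where a: "\<And>n. a n \<in> {-1, 1}" "x = (\<Sum>n. of_int (a n) * z ^ n)"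
    unfolding A_set_def by blast
  have "x = wsum z (map a [0..<k]) + z ^ k * (\<Sum>n. of_int (a (n + k)) * z ^ n)"
    using sign_series_eq_wsum_plus[of a z k] a z by simp
  moreover have "(\<Sum>n. of_int (a (n + k)) * z ^ n) \<in> A_set z"
    unfolding A_set_def using a(1) by (intro CollectI exI[of _ "\<lambda>n. a (n + k)"]) simp
  moreover have "map a [0..<k] \<in> words k" using a(1) by (auto simp: words_def)
  ultimately show "x \<in> (\<Union>u\<in>words k. (\<lambda>x. wsum z u + z ^ k * x) ` A_set z)" by blast
next
  fix x assume "x \<in> (\<Union>u\<in>words k. (\<lambda>x. wsum z u + z ^ k * x) ` A_set z)"
  then obtain u and b :: "nat \<Rightarrow> int" where u: "u \<in> words k" and b: "\<And>n. b n \<in> {-1, 1}"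
    and x: "x = wsum z u + z ^ k * (\<Sum>n. of_int (b n) * z ^ n)"
    unfolding A_set_def by blast
  define a where "a n = (if n < k then u ! n else b (n - k))" for n
  have a: "a n \<in> {-1, 1}" for n
    using b u by (auto simp: a_def words_def dest!: subsetD[OF _ nth_mem])
  moreover have "map a [0..<k] = u"
    using u by (auto simp: a_def words_def intro: nth_equalityI)
  moreover have "a (n + k) = b n" for n by (simp add: a_def)
  ultimately have "x = (\<Sum>n. of_int (a n) * z ^ n)"
    using sign_series_eq_wsum_plus[of a z k] x z by simp
  then show "x \<in> A_set z" unfolding A_set_def using a by blast
qed

lemma wsum_plus_mem_A_set:
  assumes "norm z < 1" "u \<in> words k" "x \<in> A_set z" shows "wsum z u + z ^ k * x \<in> A_set z"
  by (subst A_set_eq_UN_words[OF assms(1), of k]) (use assms in blast)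

lemma compact_A_set:
  assumes z: "norm z < 1" shows "compact (A_set z)"
proof -
  define P where "P = (PiE UNIV (\<lambda>_. {-1, 1}) :: (nat \<Rightarrow> int) set)"
  have "compactin (product_topology (\<lambda>_::nat. euclidean :: int topology) UNIV) P"
    unfolding P_def by (subst compactin_PiE) auto
  then have "compact P" by (simp add: euclidean_product_topology)
  moreover have "continuous_on P (\<lambda>a. \<Sum>n. of_int (a n) * z ^ n)"
  proof (rule uniform_limit_theorem)
    have "continuous_on P (\<lambda>a. of_int (a n) :: complex)" for n
      by (rule continuous_on_compose2[OF Topological_Spaces.continuous_on_discrete])
         (auto intro: continuous_on_subset[OF continuous_on_product_coordinates])
    then show "\<forall>\<^sub>F n in sequentially. continuous_on P (\<lambda>a. \<Sum>i<n. of_int (a i) * z ^ i)"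
      by (intro always_eventually allI continuous_on_sum continuous_on_mult continuous_on_const)
    show "uniform_limit P (\<lambda>n a. \<Sum>i<n. of_int (a i) * z ^ i) (\<lambda>a. \<Sum>n. of_int (a n) * z ^ n)
        sequentially"
    proof (rule Weierstrass_m_test)
      show "norm (of_int (a n) * z ^ n) \<le> norm z ^ n" if "a \<in> P" for n a
        using that PiE_mem[of a UNIV "\<lambda>_. {-1, 1}" n] by (auto simp: P_def norm_mult norm_power)
    qed (use z in auto)
  qed simp
  ultimately have "compact ((\<lambda>a. \<Sum>n. of_int (a n) * z ^ n) ` P)"
    by (intro compact_continuous_image)
  moreover have "A_set z = (\<lambda>a. \<Sum>n. of_int (a n) * z ^ n) ` P"
    by (auto simp: A_set_def P_def PiE_UNIV_domain image_iff)
  ultimately show ?thesis by simp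
qed

lemma power_powr_eq_powr_power:
  fixes x :: real
  assumes "0 < x" shows "(x ^ k) powr t = (x powr t) ^ k"
  using assms by (induction k) (auto simp: powr_mult)

lemma hausdorff_pre_A_set_le:
  assumes z: "norm z < 1" and \<delta>: "2 * (norm z ^ k / (1 - norm z)) \<le> \<delta>"
  shows "hausdorff_pre t \<delta> (A_set z) \<le> ennreal (2 ^ k * (2 * (norm z ^ k / (1 - norm z))) powr t)"
proof -
  let ?r = "norm z ^ k / (1 - norm z)" and ?X = "wsum z ` words k"
  have "wsum z u + z ^ k * x \<in> cball (wsum z u) ?r" if "x \<in> A_set z" for u x
    using mult_left_mono[OF norm_le_of_mem_A_set[OF z that], of "norm z ^ k"]
    by (simp add: dist_norm norm_mult norm_power)
  then have "A_set z \<subseteq> (\<Union>x\<in>?X. cball x ?r)"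
    by (subst A_set_eq_UN_words[OF z, of k]) blast
  then have "hausdorff_pre t \<delta> (A_set z) \<le> ennreal (real (card ?X) * (2 * ?r) powr t)"
    using z \<delta> by (intro hausdorff_pre_finite_cball_cover) auto
  also have "\<dots> \<le> ennreal (2 ^ k * (2 * ?r) powr t)"
    using card_image_le[of "words k" "wsum z"]
    by (intro ennreal_leI mult_right_mono) (auto simp: card_words simp flip: of_nat_le_iff)
  finally show ?thesis .
qed

lemma hausdorff_measure_A_set_eq_0:
  assumes z: "0 < norm z" "norm z < 1" and t: "2 * norm z powr t < 1"
  shows "hausdorff_measure t (A_set z) = 0"
proof -
  define \<rho> where "\<rho> = norm z"
  have \<rho>: "0 < \<rho>" "\<rho> < 1" using z by (auto simp: \<rho>_def)
  define c where "c k = (2 / (1 - \<rho>)) powr t * (2 * \<rho> powr t) ^ k" for k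
  have cost: "2 ^ k * (2 * (\<rho> ^ k / (1 - \<rho>))) powr t = c k" for k
  proof -
    have "(2 * (\<rho> ^ k / (1 - \<rho>))) powr t = (2 / (1 - \<rho>) * \<rho> ^ k) powr t" by simp
    also have "\<dots> = (2 / (1 - \<rho>)) powr t * (\<rho> powr t) ^ k"
      unfolding power_powr_eq_powr_power[OF \<rho>(1), symmetric] using \<rho> by (intro powr_mult)
    finally show ?thesis by (simp add: c_def power_mult_distrib)
  qed
  have "hausdorff_measure t {x. \<exists>\<^sub>F k in sequentially. x \<in> A_set z} = 0"
  proof (rule hausdorff_measure_limsup_eq_0[where c = c])
    show "summable c"
      unfolding c_def using t by (intro summable_mult summable_geometric) (simp add: \<rho>_def)
    show "0 \<le> c k" for k by (simp add: c_def)
    fix \<delta> :: real assume "0 < \<delta>"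
    moreover have "(\<lambda>k. 2 * (\<rho> ^ k / (1 - \<rho>))) \<longlonglongrightarrow> 2 * (0 / (1 - \<rho>))"
      using \<rho> by (intro tendsto_intros LIMSEQ_power_zero) auto
    ultimately have "\<forall>\<^sub>F k in sequentially. 2 * (\<rho> ^ k / (1 - \<rho>)) < \<delta>"
      by (intro order_tendstoD) auto
    then show "\<forall>\<^sub>F k in sequentially. hausdorff_pre t \<delta> (A_set z) \<le> ennreal (c k)"
      unfolding cost[symmetric] \<rho>_def
      by (rule eventually_mono) (intro hausdorff_pre_A_set_le z less_imp_le)
  qed
  then show ?thesis by simp
qed

definition close_pairs :: "real \<Rightarrow> complex \<Rightarrow> nat \<Rightarrow> (int list \<times> int list) set" where
  "close_pairs K z m = {(u, v) \<in> words m \<times> words m. norm (wsum z u - wsum z v) \<le> K * norm z ^ m}"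

definition excess_growth :: "real \<Rightarrow> real \<Rightarrow> complex \<Rightarrow> bool" where
  "excess_growth K b z \<longleftrightarrow> (\<forall>A. \<exists>m. A * b ^ m < real (card (close_pairs K z m)))"

definition neighbours :: "real \<Rightarrow> complex \<Rightarrow> int list \<Rightarrow> int list set" where
  "neighbours K z v = {w \<in> words (length v). norm (wsum z v - wsum z w) \<le> K * norm z ^ length v}"

lemma finite_close_pairs [simp]: "finite (close_pairs K z m)"
  unfolding close_pairs_def by (rule finite_subset[of _ "words m \<times> words m"]) auto

lemma neighbours_subset_words: "v \<in> words n \<Longrightarrow> neighbours K z v \<subseteq> words n"
  by (auto simp: neighbours_def length_words)

lemma sum_card_neighbours: "(\<Sum>v\<in>words n. card (neighbours K z v)) = card (close_pairs K z n)"
proof -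
  have "close_pairs K z n = (SIGMA v:words n. neighbours K z v)"
    by (auto simp: close_pairs_def neighbours_def length_words)
  then show ?thesis by (simp add: neighbours_def)
qed

lemma take_mem_neighbours:
  assumes z: "norm z < 1" and K: "1 + 2 / (1 - norm z) \<le> K" and x: "x \<in> A_set z"
    and uv: "u \<in> words M" "v \<in> words M" and n: "n \<le> M"
    and close: "dist (wsum z v + z ^ M * x) (wsum z u + z ^ M * x) \<le> norm z ^ n"
  shows "take n u \<in> neighbours K z (take n v)"
proof -
  have prefix: "norm (wsum z w + z ^ M * x - wsum z (take n w)) \<le> norm z ^ n / (1 - norm z)"
    if w: "w \<in> words M" for w
  proof -
    let ?tail = "wsum z (drop n w) + z ^ (M - n) * x"
    have "z ^ M = z ^ n * z ^ (M - n)" using n by (simp flip: power_add)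
    then have "wsum z w + z ^ M * x - wsum z (take n w) = z ^ n * ?tail"
      using wsum_take_drop[OF w n, of z] by (simp add: algebra_simps)
    moreover have "norm ?tail \<le> 1 / (1 - norm z)"
      by (intro norm_le_of_mem_A_set wsum_plus_mem_A_set z x drop_words[OF w])
    ultimately show ?thesis
      using mult_left_mono[of "norm ?tail" "1 / (1 - norm z)" "norm z ^ n"]
      by (simp add: norm_mult norm_power)
  qed
  have "norm (wsum z (take n v) - wsum z (take n u))
      \<le> norm (wsum z v + z ^ M * x - wsum z (take n v))
        + norm (wsum z v + z ^ M * x - (wsum z u + z ^ M * x))
        + norm (wsum z u + z ^ M * x - wsum z (take n u))"
    by norm
  also have "\<dots> \<le> (1 + 2 / (1 - norm z)) * norm z ^ n"
    using prefix[OF uv(1)] prefix[OF uv(2)] close by (simp add: dist_norm algebra_simps)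
  also have "\<dots> \<le> K * norm z ^ n" by (intro mult_right_mono K) simp
  finally show ?thesis
    using take_words[OF uv(1) n] length_words[OF take_words[OF uv(2) n]]
    by (simp add: neighbours_def)
qed

lemma ex_power_bracket:
  fixes \<rho> d :: real
  assumes "\<rho> ^ M < d" "d \<le> 1"
  obtains n where "n < M" "d \<le> \<rho> ^ n" "\<rho> ^ Suc n < d"
  using ex_least_nat_less[of "\<lambda>n. \<rho> ^ n < d" M] assms that by (force simp: not_less)

definition regular_words :: "real \<Rightarrow> real \<Rightarrow> real \<Rightarrow> complex \<Rightarrow> nat \<Rightarrow> int list set" where
  "regular_words K C \<theta> z M =
     {u \<in> words M. \<forall>n\<le>M. real (card (neighbours K z (take n u))) \<le> C * \<theta> ^ n}"

lemma not_excess_growth_imp_many_regular_words: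
  assumes b: "0 < b" "b < 2 * \<theta>" and growth: "\<not> excess_growth K b z"
  obtains C where "0 < C" "\<And>M. 2 ^ M \<le> 2 * real (card (regular_words K C \<theta> z M))"
proof -
  obtain A where A: "\<And>m. real (card (close_pairs K z m)) \<le> A * b ^ m"
    using growth unfolding excess_growth_def by (auto simp: not_less)
  have sum_le: "(\<Sum>v\<in>words n. real (card (neighbours K z v))) \<le> max 1 A * (2 * (b / 2)) ^ n" for n
  proof -
    have "(\<Sum>v\<in>words n. real (card (neighbours K z v))) = real (card (close_pairs K z n))"
      by (simp flip: sum_card_neighbours)
    also have "\<dots> \<le> max 1 A * b ^ n"
      using b(1) by (intro order_trans[OF A] mult_right_mono) auto
    finally show ?thesis by simp
  qed
  have "0 < max 1 A" "0 < b / 2" "b / 2 < \<theta>" using b by auto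
  then show ?thesis
    using half_words_prefixes_le[OF of_nat_0_le_iff sum_le] that
    unfolding regular_words_def by blast
qed

lemma card_regular_words_in_small_set_le:
  assumes z: "0 < norm z" "norm z < 1" and K: "1 + 2 / (1 - norm z) \<le> K"
    and x: "x \<in> A_set z" and t: "0 \<le> t" and C: "0 \<le> C"
    and d: "norm z ^ M < d" "d \<le> 1" and V: "\<forall>x\<in>V. \<forall>y\<in>V. dist x y \<le> d"
  shows "real (card {u \<in> regular_words K C (2 * norm z powr t) z M. wsum z u + z ^ M * x \<in> V})
    \<le> C / norm z powr t * d powr t * 2 ^ M" (is "real (card ?W) \<le> _")
proof (cases "?W = {}")
  case True
  then show ?thesis using C by (simp only: card.empty) simp
next
  case False
  then obtain v where v: "v \<in> regular_words K C (2 * norm z powr t) z M"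
    "wsum z v + z ^ M * x \<in> V" by blast
  obtain n where n: "n < M" "d \<le> norm z ^ n" "norm z ^ Suc n < d"
    by (rule ex_power_bracket[OF d])
  let ?P = "neighbours K z (take n v)"
  have v_words: "v \<in> words M" and card_P: "real (card ?P) \<le> C * (2 * norm z powr t) ^ n"
    using v(1) n(1) by (auto simp: regular_words_def)
  have "?W \<subseteq> {u \<in> words M. take n u \<in> ?P}"
  proof safe
    fix u assume u: "u \<in> regular_words K C (2 * norm z powr t) z M" "wsum z u + z ^ M * x \<in> V"
    then show u_words: "u \<in> words M" by (simp add: regular_words_def)
    have "dist (wsum z v + z ^ M * x) (wsum z u + z ^ M * x) \<le> norm z ^ n"
      using V v(2) u(2) n(2) by force
    then show "take n u \<in> ?P"
      using n(1) by (intro take_mem_neighbours[OF z(2) K x u_words v_words]) auto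
  qed
  then have "card ?W \<le> card {u \<in> words M. take n u \<in> ?P}"
    by (intro card_mono) auto
  also have "\<dots> \<le> card ?P * 2 ^ (M - n)"
    using v_words n(1) by (intro card_words_take_in_le neighbours_subset_words take_words) auto
  finally have "real (card ?W) \<le> real (card ?P * 2 ^ (M - n))" by (simp only: of_nat_le_iff)
  also have "\<dots> \<le> C * (2 * norm z powr t) ^ n * 2 ^ (M - n)"
    using card_P by (simp add: mult_right_mono)
  also have "\<dots> = C * (norm z powr t) ^ n * (2 ^ n * 2 ^ (M - n))" by (simp add: power_mult_distrib)
  also have "(2::real) ^ n * 2 ^ (M - n) = 2 ^ M" using n(1) by (simp flip: power_add)
  also have "(norm z powr t) ^ n = (norm z ^ Suc n) powr t / norm z powr t"
    using z by (simp add: powr_mult power_powr_eq_powr_power)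
  also have "\<dots> \<le> d powr t / norm z powr t"
    using n(3) z t by (intro divide_right_mono powr_mono2) auto
  finally show ?thesis using C by (simp add: mult_left_mono mult_right_mono)
qed

lemma hausdorff_measure_A_set_neq_0:
  assumes z: "0 < norm z" "norm z < 1" and K: "1 + 2 / (1 - norm z) \<le> K"
    and b: "0 < b" "b < 4 * norm z powr t" "\<not> excess_growth K b z" and t: "0 < t"
  shows "hausdorff_measure t (A_set z) \<noteq> 0"
proof -
  have "b < 2 * (2 * norm z powr t)" using b(2) by simp
  then obtain C where C: "0 < C" and
    many: "\<And>M. 2 ^ M \<le> 2 * real (card (regular_words K C (2 * norm z powr t) z M))"
    using not_excess_growth_imp_many_regular_words[OF b(1) _ b(3)] by blast
  define G where "G = regular_words K C (2 * norm z powr t) z"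
  obtain x where x: "x \<in> A_set z" using A_set_nonempty by blast
  define p where "p M u = wsum z u + z ^ M * x" for M u
  define D where "D = C / norm z powr t"
  have D: "0 < D" using C z by (simp add: D_def)
  show ?thesis
  proof (rule mass_distribution_principle[OF compact_A_set[OF z(2)] t, of "2 * D"])
    fix \<delta> :: real assume "0 < \<delta>"
    then obtain M where M: "norm z ^ M < \<delta>" using real_arch_pow_inv z(2) by blast
    have "real (card {u \<in> G M. p M u \<in> V}) \<le> 2 * D * d powr t * real (card (G M))"
      if "\<delta> \<le> d" "d \<le> 1" "\<forall>x\<in>V. \<forall>y\<in>V. dist x y \<le> d" for d V
    proof -
      have "real (card {u \<in> G M. p M u \<in> V}) \<le> D * d powr t * 2 ^ M"
        unfolding p_def D_def G_def using that M C t
        by (intro card_regular_words_in_small_set_le[OF z K x]) auto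
      also have "\<dots> \<le> D * d powr t * (2 * real (card (G M)))"
        unfolding G_def using D by (intro mult_left_mono many) simp
      finally show ?thesis by simp
    qed
    moreover have "0 < card (G M)"
      using order_less_le_trans[OF zero_less_power many[of M]] by (simp add: G_def)
    then have "finite (G M)" "G M \<noteq> {}" by (auto simp: card_gt_0_iff)
    moreover have "p M ` G M \<subseteq> A_set z"
      using wsum_plus_mem_A_set[OF z(2) _ x] by (auto simp: p_def G_def regular_words_def)
    ultimately show "\<exists>(G :: int list set) p. finite G \<and> G \<noteq> {} \<and> p ` G \<subseteq> A_set z \<and>
      (\<forall>d V. \<delta> \<le> d \<longrightarrow> d \<le> 1 \<longrightarrow> (\<forall>x\<in>V. \<forall>y\<in>V. dist x y \<le> d) \<longrightarrow>
        real (card {g \<in> G. p g \<in> V}) \<le> 2 * D * d powr t * real (card G))"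
      by blast
  qed (use D in simp)
qed

section \<open>Parameters with too many close pairs\<close>

definition split_close_pairs :: "real \<Rightarrow> complex \<Rightarrow> nat \<Rightarrow> (int list \<times> int list) set" where
  "split_close_pairs K z m = {(u, v) \<in> close_pairs K z m. hd u \<noteq> hd v}"

lemma finite_split_close_pairs [simp]: "finite (split_close_pairs K z m)"
  by (rule finite_subset[OF _ finite_close_pairs]) (auto simp: split_close_pairs_def)

lemma card_close_pairs_Suc_le:
  assumes z: "z \<noteq> 0"
  shows "card (close_pairs K z (Suc m))
    \<le> card (split_close_pairs K z (Suc m)) + 2 * card (close_pairs K z m)"
proof -
  let ?P = "split_close_pairs K z (Suc m)"
  let ?cons = "\<lambda>(x, (u, v)). (x # u, x # v)"
  let ?S = "{-1, 1 :: int} \<times> close_pairs K z m"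
  have "close_pairs K z (Suc m) \<subseteq> ?P \<union> ?cons ` ?S"
  proof (rule subrelI, rule UnCI)
    fix u v assume uv: "(u, v) \<in> close_pairs K z (Suc m)" and same: "(u, v) \<notin> ?cons ` ?S"
    obtain x u' where u: "u = x # u'" "x \<in> {-1, 1}" "u' \<in> words m"
      using uv by (auto simp: close_pairs_def elim: words_SucE)
    obtain y v' where v: "v = y # v'" "v' \<in> words m"
      using uv by (auto simp: close_pairs_def elim: words_SucE)
    have "(u', v') \<in> close_pairs K z m" if "x = y"
    proof -
      have "wsum z u - wsum z v = z * (wsum z u' - wsum z v')"
        using that u v by (simp add: algebra_simps)
      then have "norm z * norm (wsum z u' - wsum z v') \<le> norm z * (K * norm z ^ m)"
        using uv by (simp add: close_pairs_def norm_mult mult_ac)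
      then show ?thesis using z u v by (simp add: close_pairs_def)
    qed
    then have "x \<noteq> y" using same u v by force
    then show "(u, v) \<in> ?P" using uv u v by (simp add: split_close_pairs_def)
  qed
  then have "card (close_pairs K z (Suc m)) \<le> card (?P \<union> ?cons ` ?S)"
    by (rule card_mono[rotated]) simp
  also have "\<dots> \<le> card ?P + card ?S"
    by (intro order_trans[OF card_Un_le] add_left_mono card_image_le) simp
  finally show ?thesis by (simp add: card_cartesian_product)
qed

lemma card_close_pairs_prefix_le:
  assumes z: "z \<noteq> 0" and K: "0 < K" and k: "k \<le> m" and T: "T \<subseteq> words k \<times> words k"
    and Q: "Q \<subseteq> close_pairs K z m" "\<And>u v. (u, v) \<in> Q \<Longrightarrow> (take k u, take k v) \<in> T"
  shows "card Q \<le> card T * (36 * card (close_pairs K z (m - k)))"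
proof -
  define F where "F = (\<lambda>(u, v). {(x, y) \<in> words (m - k) \<times> words (m - k).
      norm ((wsum z u - wsum z v) / z ^ k + wsum z x - wsum z y) \<le> K * norm z ^ (m - k)})"
  have finite_T: "finite T" by (rule finite_subset[OF T]) simp
  have finite_F: "finite (F p)" for p
    by (rule finite_subset[of _ "words (m - k) \<times> words (m - k)"])
       (auto simp: F_def split: prod.splits)
  have card_F: "card (F p) \<le> 36 * card (close_pairs K z (m - k))" for p
  proof (cases p)
    case (Pair u v)
    show ?thesis unfolding F_def close_pairs_def Pair prod.case
      using z K by (intro card_translated_close_le) auto
  qed
  let ?append = "\<lambda>((u, v), (x, y)). (u @ x, v @ y)"
  have "Q \<subseteq> ?append ` Sigma T F"
  proof clarify
    fix u v assume uv: "(u, v) \<in> Q"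
    then have w: "u \<in> words m" "v \<in> words m"
      and close: "norm (wsum z u - wsum z v) \<le> K * norm z ^ m"
      using Q(1) by (auto simp: close_pairs_def)
    let ?x = "(wsum z (take k u) - wsum z (take k v)) / z ^ k
      + wsum z (drop k u) - wsum z (drop k v)"
    have "wsum z u - wsum z v = z ^ k * ?x"
      using wsum_take_drop[OF w(1) k] wsum_take_drop[OF w(2) k] z by (simp add: field_simps)
    moreover have "norm z ^ m = norm z ^ k * norm z ^ (m - k)" using k by (simp flip: power_add)
    ultimately have "norm z ^ k * norm ?x \<le> norm z ^ k * (K * norm z ^ (m - k))"
      using close by (simp add: norm_mult norm_power mult_ac)
    then have "norm ?x \<le> K * norm z ^ (m - k)"
      by (rule mult_left_le_imp_le) (use z in simp)
    then have "((take k u, take k v), (drop k u, drop k v)) \<in> Sigma T F"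
      using Q(2)[OF uv] w drop_words by (simp add: F_def)
    then show "(u, v) \<in> ?append ` Sigma T F" by (rule rev_image_eqI) simp
  qed
  then have "card Q \<le> card (?append ` Sigma T F)"
    using finite_T finite_F by (intro card_mono) auto
  also have "\<dots> \<le> card (Sigma T F)" using finite_T finite_F by (intro card_image_le) auto
  also have "\<dots> = (\<Sum>p\<in>T. card (F p))" using finite_T finite_F by simp
  also have "\<dots> \<le> (\<Sum>p\<in>T. 36 * card (close_pairs K z (m - k)))" by (intro sum_mono card_F)
  finally show ?thesis by simp
qed

definition record_level :: "real \<Rightarrow> real \<Rightarrow> complex \<Rightarrow> nat \<Rightarrow> bool" where
  "record_level K b z m \<longleftrightarrow>
     (\<forall>k\<le>m. real (card (close_pairs K z (m - k))) * b ^ k \<le> real (card (close_pairs K z m)))"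

lemma record_levelD:
  "record_level K b z m \<Longrightarrow> k \<le> m \<Longrightarrow>
    real (card (close_pairs K z (m - k))) * b ^ k \<le> real (card (close_pairs K z m))"
  by (simp add: record_level_def)

lemma excess_growth_record_levelE:
  assumes "excess_growth K b z" "0 < b"
  obtains m where "m0 \<le> m" "record_level K b z m"
proof -
  define N where "N m = real (card (close_pairs K z m))" for m
  have "\<exists>m. A < N m / b ^ m" for A
    using assms by (auto simp: excess_growth_def N_def pos_less_divide_eq)
  then obtain m where m: "m0 \<le> m" "\<And>n. n \<le> m \<Longrightarrow> N n / b ^ n \<le> N m / b ^ m"
    using ex_record[of "\<lambda>m. N m / b ^ m"] by metis
  have "N (m - k) * b ^ k \<le> N m" if "k \<le> m" for k
    using m(2)[of "m - k"] that assms(2) by (simp add: power_diff field_simps)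
  then show ?thesis using that m(1) by (simp add: N_def record_level_def)
qed

definition word_diff :: "int list \<Rightarrow> int list \<Rightarrow> complex \<Rightarrow> complex" where
  "word_diff u v z = wsum z u - wsum z v"

lemma norm_wsum_le:
  assumes "norm z < 1" "w \<in> words m" shows "norm (wsum z w) \<le> 1 / (1 - norm z)"
  using assms(2)
proof (induction m arbitrary: w)
  case (Suc m)
  then obtain x v where w: "w = x # v" "x \<in> {-1, 1}" "v \<in> words m" by (auto elim: words_SucE)
  have "norm (wsum z w) \<le> norm (of_int x :: complex) + norm z * norm (wsum z v)"
    using norm_triangle_ineq[of "of_int x" "z * wsum z v"] by (simp add: w(1) norm_mult)
  also have "\<dots> \<le> 1 + norm z * (1 / (1 - norm z))"
    using w(2) Suc.IH[OF w(3)] by (intro add_mono mult_left_mono) auto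
  also have "\<dots> = 1 / (1 - norm z)" using assms(1) by (simp add: field_simps)
  finally show ?case .
qed (use assms(1) in \<open>simp add: words_def\<close>)

lemma holomorphic_on_word_diff: "word_diff u v holomorphic_on S"
proof -
  have "(\<lambda>z. wsum z w) holomorphic_on S" for w
    by (induction w) (auto intro!: holomorphic_intros)
  then show ?thesis unfolding word_diff_def by (intro holomorphic_on_diff)
qed

lemma geometrically_bounded_word_diff:
  assumes "u \<in> words m" "v \<in> words m" shows "geometrically_bounded 2 (word_diff u v)"
  unfolding geometrically_bounded_def
proof (intro conjI ballI holomorphic_on_word_diff)
  fix z :: complex assume "z \<in> ball 0 1"
  then show "norm (word_diff u v z) \<le> 2 / (1 - norm z)"
    using norm_triangle_ineq4[of "wsum z u" "wsum z v"]
      norm_wsum_le[of z u m] norm_wsum_le[of z v m] assms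
    by (simp add: word_diff_def)
qed

lemma norm_word_diff_0:
  assumes "u \<in> words m" "v \<in> words m" "hd u \<noteq> hd v" shows "2 \<le> norm (word_diff u v 0)"
proof (cases m)
  case 0
  then show ?thesis using assms by (simp add: words_def)
next
  case (Suc n)
  then obtain x u' y v' where "u = x # u'" "x \<in> {-1, 1}" "v = y # v'" "y \<in> {-1, 1}"
    using assms(1,2) by (metis words_SucE)
  then show ?thesis using assms(3) by (auto simp: word_diff_def)
qed

lemma higher_deriv_word_diff_take_drop:
  assumes "u \<in> words m" "v \<in> words m" "k \<le> m"
  shows "(deriv ^^ i) (word_diff u v) z = (deriv ^^ i) (word_diff (take k u) (take k v)) z
    + (deriv ^^ i) (\<lambda>w. w ^ k * word_diff (drop k u) (drop k v) w) z"
proof -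
  have "word_diff u v =
      (\<lambda>w. word_diff (take k u) (take k v) w + w ^ k * word_diff (drop k u) (drop k v) w)"
    using wsum_take_drop[OF assms(1,3)] wsum_take_drop[OF assms(2,3)]
    by (auto simp: word_diff_def algebra_simps)
  moreover have "(\<lambda>w. w ^ k * word_diff (drop k u) (drop k v) w) holomorphic_on UNIV"
    by (intro holomorphic_intros holomorphic_on_word_diff)
  ultimately show ?thesis
    using higher_deriv_add[OF holomorphic_on_word_diff _ open_UNIV UNIV_I] by simp
qed

definition near_zero_pairs :: "real \<Rightarrow> real \<Rightarrow> nat \<Rightarrow> nat \<Rightarrow> complex \<Rightarrow> (int list \<times> int list) set" where
  "near_zero_pairs \<rho> \<tau> k i z = {(u, v) \<in> words k \<times> words k.
     norm ((deriv ^^ i) (word_diff u v) z) \<le> \<rho> \<and> \<tau> \<le> norm ((deriv ^^ Suc i) (word_diff u v) z)}"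

definition near_zero_scaled :: "real \<Rightarrow> real \<Rightarrow> nat \<Rightarrow> nat \<Rightarrow> complex \<Rightarrow> (int list \<times> int list) set" where
  "near_zero_scaled R \<eta> k i z = near_zero_pairs ((\<eta> * R) ^ k) ((1 / \<eta>) ^ k) k i z"

definition near_zero_rich :: "real \<Rightarrow> real \<Rightarrow> real \<Rightarrow> real \<Rightarrow> nat \<Rightarrow> nat \<Rightarrow> complex set" where
  "near_zero_rich R \<rho> \<tau> L k i = {z. norm z \<le> R \<and> L \<le> real (card (near_zero_pairs \<rho> \<tau> k i z))}"

definition rich_level :: "real \<Rightarrow> real \<Rightarrow> real \<Rightarrow> real \<Rightarrow> nat \<Rightarrow> nat \<Rightarrow> complex set" where
  "rich_level R \<eta> c b i k = near_zero_rich R ((\<eta> * R) ^ k) ((1 / \<eta>) ^ k) (c * b ^ k) k i"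

lemma near_zero_pairs_subset: "near_zero_pairs \<rho> \<tau> k i z \<subseteq> words k \<times> words k"
  by (auto simp: near_zero_pairs_def)

lemma higher_deriv_word_diff_take_eventually_close:
  assumes R: "0 \<le> R" "R < S" "R < 1" and e: "0 < e"
  shows "\<forall>\<^sub>F k in sequentially. \<forall>m\<ge>k. \<forall>u\<in>words m. \<forall>v\<in>words m. \<forall>z. norm z \<le> R \<longrightarrow>
    norm ((deriv ^^ i) (word_diff u v) z - (deriv ^^ i) (word_diff (take k u) (take k v)) z)
      \<le> e * S ^ k"
  using higher_deriv_power_mult_eventually_le[OF R e, of 2 i]
proof (eventually_elim, intro allI ballI impI)
  fix k m u v and z :: complex
  assume bound: "\<forall>f z. geometrically_bounded 2 f \<longrightarrow> norm z \<le> R \<longrightarrow>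
      norm ((deriv ^^ i) (\<lambda>w. w ^ k * f w) z) \<le> e * S ^ k"
    and m: "k \<le> m" and w: "u \<in> words m" "v \<in> words m" and z: "norm z \<le> R"
  have "geometrically_bounded 2 (word_diff (drop k u) (drop k v))"
    by (rule geometrically_bounded_word_diff[OF drop_words[OF w(1)] drop_words[OF w(2)]])
  then show "norm ((deriv ^^ i) (word_diff u v) z
      - (deriv ^^ i) (word_diff (take k u) (take k v)) z) \<le> e * S ^ k"
    unfolding higher_deriv_word_diff_take_drop[OF w m] using bound z by simp
qed

definition jumps_inherited_by_prefixes :: "real \<Rightarrow> real \<Rightarrow> real \<Rightarrow> nat \<Rightarrow> nat \<Rightarrow> nat \<Rightarrow> bool" where
  "jumps_inherited_by_prefixes R \<eta> K q k i \<longleftrightarrow>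
     (\<forall>m\<ge>k. \<forall>u\<in>words m. \<forall>v\<in>words m. \<forall>z. norm z \<le> R \<longrightarrow>
        norm ((deriv ^^ i) (word_diff u v) z) \<le> K * R ^ k \<longrightarrow>
        K * R ^ (k div q) \<le> norm ((deriv ^^ Suc i) (word_diff u v) z) \<longrightarrow>
        (take k u, take k v) \<in> near_zero_scaled R \<eta> k i z)"

lemma jumps_inherited_by_prefixes_eventually:
  assumes R: "0 < R" "R < 1" and \<eta>: "1 < \<eta>" "\<eta> ^ 2 * R < 1" and K: "2 \<le> K" and q: "1 \<le> R * \<eta> ^ q"
  shows "\<forall>\<^sub>F k in sequentially. jumps_inherited_by_prefixes R \<eta> K q k i"
proof -
  have "R < \<eta> * R" using R \<eta> by simp
  then have close: "\<forall>\<^sub>F k in sequentially. \<forall>m\<ge>k. \<forall>u\<in>words m. \<forall>v\<in>words m. \<forall>z. norm z \<le> R \<longrightarrow>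
    norm ((deriv ^^ j) (word_diff u v) z - (deriv ^^ j) (word_diff (take k u) (take k v)) z)
      \<le> 1/2 * (\<eta> * R) ^ k" for j
    using R by (intro higher_deriv_word_diff_take_eventually_close) auto
  have "(\<lambda>k. K * (1 / \<eta>) ^ k) \<longlonglongrightarrow> K * 0"
    using \<eta> by (intro tendsto_mult_left LIMSEQ_power_zero) auto
  then have "\<forall>\<^sub>F k in sequentially. K * (1 / \<eta>) ^ k < 1/2" by (intro order_tendstoD) auto
  from this close[of i] close[of "Suc i"] show ?thesis
    unfolding jumps_inherited_by_prefixes_def
  proof (eventually_elim, intro allI ballI impI)
    case (elim k)
    fix m u v z
    assume m: "k \<le> m" and w: "u \<in> words m" "v \<in> words m" and z: "norm z \<le> R"
      and small: "norm ((deriv ^^ i) (word_diff u v) z) \<le> K * R ^ k"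
      and large: "K * R ^ (k div q) \<le> norm ((deriv ^^ Suc i) (word_diff u v) z)"
    let ?D = "\<lambda>j. (deriv ^^ j) (word_diff u v) z"
    let ?d = "\<lambda>j. (deriv ^^ j) (word_diff (take k u) (take k v)) z"
    have "K * R ^ k = K * (1 / \<eta>) ^ k * (\<eta> * R) ^ k"
      using \<eta> by (simp add: power_mult_distrib power_divide)
    also have "\<dots> \<le> 1/2 * (\<eta> * R) ^ k" using elim(1) R \<eta> by (intro mult_right_mono) auto
    finally have "norm (?D i) \<le> 1/2 * (\<eta> * R) ^ k" using small by simp
    moreover have "norm (?D i - ?d i) \<le> 1/2 * (\<eta> * R) ^ k" using elim(2) m w z by blast
    ultimately have upper: "norm (?d i) \<le> (\<eta> * R) ^ k"
      using norm_triangle_ineq4[of "?D i" "?D i - ?d i"] by simp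
    have "(1 / \<eta>) ^ k \<le> (1 / \<eta>) ^ (q * (k div q))" using \<eta> by (intro power_decreasing) auto
    also have "\<dots> \<le> R ^ (k div q)"
      unfolding power_mult using q \<eta> R by (intro power_mono) (auto simp: power_divide field_simps)
    finally have "2 * (1 / \<eta>) ^ k \<le> K * R ^ (k div q)" using K R \<eta> by (intro mult_mono) auto
    moreover have "(\<eta> * R) ^ k \<le> (1 / \<eta>) ^ k"
      using \<eta> R by (intro power_mono) (auto simp: field_simps power2_eq_square)
    moreover have "norm (?D (Suc i) - ?d (Suc i)) \<le> 1/2 * (\<eta> * R) ^ k" using elim(3) m w z by blast
    moreover have "0 \<le> (1 / \<eta>) ^ k" using \<eta> by simp
    ultimately have "(1 / \<eta>) ^ k \<le> norm (?d (Suc i))"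
      using large norm_triangle_ineq2[of "?D (Suc i)" "?d (Suc i)"] by linarith
    with upper show "(take k u, take k v) \<in> near_zero_scaled R \<eta> k i z"
      using take_words[OF w(1) m] take_words[OF w(2) m]
      unfolding near_zero_scaled_def near_zero_pairs_def by blast
  qed
qed

lemma le_div_power:
  fixes m n q :: nat
  assumes "n * q ^ j \<le> m" "i \<le> j" "0 < q" shows "n \<le> m div q ^ i"
proof -
  have "n * q ^ i \<le> n * q ^ j" using assms by (intro mult_left_mono power_increasing) auto
  then have "n * q ^ i \<le> m" using assms(1) by (rule order_trans)
  then show ?thesis using assms(3) by (simp add: less_eq_div_iff_mult_less_eq)
qed

text \<open>Dividing the level by q at each order leaves room between the threshold for the derivative of
  order j + 1 and the precision to which a prefix of length m div q^j controls the one of order j.\<close>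
lemma ex_higher_deriv_jump:
  assumes K: "0 \<le> K" and q: "0 < q"
    and c: "\<And>k. n \<le> k \<Longrightarrow> K * R ^ k < c" and m: "n * q ^ J \<le> m"
    and z: "norm z \<le> R" and uv: "(u, v) \<in> close_pairs K z m"
    and order: "i \<le> J" "c \<le> norm ((deriv ^^ i) (word_diff u v) z)"
  obtains j where "j < J" "norm ((deriv ^^ j) (word_diff u v) z) \<le> K * R ^ (m div q ^ j)"
    "K * R ^ (m div q ^ j div q) \<le> norm ((deriv ^^ Suc j) (word_diff u v) z)"
proof -
  define D where "D i = norm ((deriv ^^ i) (word_diff u v) z)" for i
  have "D 0 \<le> K * norm z ^ m" using uv by (simp add: D_def close_pairs_def word_diff_def)
  also have "\<dots> \<le> K * R ^ (m div q ^ 0)" using z K by (simp add: mult_left_mono power_mono)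
  finally have "\<not> K * R ^ (m div q ^ 0) < D 0" by simp
  moreover have "K * R ^ (m div q ^ i) < D i"
    using c[OF le_div_power[OF m order(1) q]] order(2) by (simp add: D_def)
  ultimately obtain j where j: "j < i" "D j \<le> K * R ^ (m div q ^ j)"
    "K * R ^ (m div q ^ Suc j) < D (Suc j)"
    using ex_least_nat_less[of "\<lambda>i. K * R ^ (m div q ^ i) < D i" i] by (auto simp: not_less)
  moreover have "m div q ^ Suc j = m div q ^ j div q" unfolding power_Suc2 by (rule div_mult2_eq)
  ultimately show ?thesis
    using that[of j] order(1) unfolding D_def by simp
qed

lemma split_close_pair_prefix_near_zeroE:
  assumes R: "0 < R" "R < 1" and \<eta>: "1 < \<eta>" "\<eta> ^ 2 * R < 1" and K: "2 \<le> K" and q: "1 \<le> R * \<eta> ^ q"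
  obtains J n where "\<And>m u v z. n * q ^ J \<le> m \<Longrightarrow> norm z \<le> R \<Longrightarrow> (u, v) \<in> split_close_pairs K z m \<Longrightarrow>
    \<exists>j<J. (take (m div q ^ j) u, take (m div q ^ j) v) \<in> near_zero_scaled R \<eta> (m div q ^ j) j z"
proof -
  obtain J c where c: "0 < c" and order_bounded: "\<And>f z. geometrically_bounded 2 f \<Longrightarrow>
      2 \<le> norm (f 0) \<Longrightarrow> norm z \<le> R \<Longrightarrow> \<exists>i\<le>J. c \<le> norm ((deriv ^^ i) f z)"
    by (rule geometrically_bounded_order_bounded[OF R(2) zero_less_numeral]) blast
  have "0 < q" using q R by (cases q) auto
  have "\<forall>\<^sub>F k in sequentially. \<forall>i\<in>{..J}. jumps_inherited_by_prefixes R \<eta> K q k i"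
    by (intro eventually_ball_finite ballI jumps_inherited_by_prefixes_eventually assms) simp
  moreover have "(\<lambda>k. K * R ^ k) \<longlonglongrightarrow> K * 0"
    using R by (intro tendsto_mult_left LIMSEQ_power_zero) auto
  then have "\<forall>\<^sub>F k in sequentially. K * R ^ k < c" using c by (intro order_tendstoD) auto
  ultimately have "\<forall>\<^sub>F k in sequentially.
      (\<forall>i\<in>{..J}. jumps_inherited_by_prefixes R \<eta> K q k i) \<and> K * R ^ k < c"
    by (rule eventually_conj)
  then obtain n where inherited: "\<And>k i. n \<le> k \<Longrightarrow> i \<le> J \<Longrightarrow> jumps_inherited_by_prefixes R \<eta> K q k i"
    and below: "\<And>k. n \<le> k \<Longrightarrow> K * R ^ k < c"
    unfolding eventually_sequentially by auto
  show ?thesis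
  proof (rule that)
    fix m u v z
    assume m: "n * q ^ J \<le> m" and z: "norm z \<le> R" and "(u, v) \<in> split_close_pairs K z m"
    then have uv: "(u, v) \<in> close_pairs K z m" and hd: "hd u \<noteq> hd v"
      by (auto simp: split_close_pairs_def)
    have w: "u \<in> words m" "v \<in> words m" using uv by (auto simp: close_pairs_def)
    obtain i where i: "i \<le> J" "c \<le> norm ((deriv ^^ i) (word_diff u v) z)"
      using order_bounded[OF geometrically_bounded_word_diff[OF w] norm_word_diff_0[OF w hd] z]
      by blast
    have "0 \<le> K" using K by simp
    obtain j where j: "j < J" "norm ((deriv ^^ j) (word_diff u v) z) \<le> K * R ^ (m div q ^ j)"
      "K * R ^ (m div q ^ j div q) \<le> norm ((deriv ^^ Suc j) (word_diff u v) z)"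
      by (rule ex_higher_deriv_jump[OF \<open>0 \<le> K\<close> \<open>0 < q\<close> below m z uv i])
    have "jumps_inherited_by_prefixes R \<eta> K q (m div q ^ j) j"
      using j(1) by (intro inherited le_div_power[OF m _ \<open>0 < q\<close>]) auto
    then show "\<exists>j<J. (take (m div q ^ j) u, take (m div q ^ j) v)
        \<in> near_zero_scaled R \<eta> (m div q ^ j) j z"
      using j w z unfolding jumps_inherited_by_prefixes_def by (meson div_le_dividend)
  qed
qed

lemma card_close_pairs_le_at_record_level:
  assumes z: "z \<noteq> 0" and b: "0 < b" and m: "m \<noteq> 0" and rec: "record_level K b z m"
  shows "(1 - 2 / b) * real (card (close_pairs K z m)) \<le> real (card (split_close_pairs K z m))"
proof -
  let ?N = "\<lambda>m. real (card (close_pairs K z m))"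
  have "card (close_pairs K z m)
      \<le> card (split_close_pairs K z m) + 2 * card (close_pairs K z (m - 1))"
    using card_close_pairs_Suc_le[OF z, of K "m - 1"] m by simp
  then have "?N m \<le> real (card (split_close_pairs K z m) + 2 * card (close_pairs K z (m - 1)))"
    by (simp only: of_nat_le_iff)
  moreover have "?N (m - 1) \<le> ?N m / b"
    using record_levelD[OF rec, of 1] m b by (simp add: pos_le_divide_eq)
  ultimately show ?thesis by (simp add: left_diff_distrib)
qed

lemma card_close_pairs_pos_at_record_level:
  assumes "0 < K" "0 < b" and rec: "record_level K b z m"
  shows "0 < card (close_pairs K z m)"
proof -
  have "([], []) \<in> close_pairs K z 0" using assms(1) by (simp add: close_pairs_def words_def)
  then have "0 < card (close_pairs K z 0)" by (metis card_gt_0_iff empty_iff finite_close_pairs)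
  then have "0 < real (card (close_pairs K z 0)) * b ^ m" using assms(2) by simp
  also have "\<dots> \<le> real (card (close_pairs K z m))" using record_levelD[OF rec, of m] by simp
  finally show ?thesis by simp
qed

lemma ex_many_prefixes_at_record_level:
  assumes z: "z \<noteq> 0" and K: "0 < K" and b: "2 < b" and m: "m \<noteq> 0" and rec: "record_level K b z m"
    and T: "\<And>j. k j \<le> m" "\<And>j. T j \<subseteq> words (k j) \<times> words (k j)"
    and prefix: "\<And>u v. (u, v) \<in> split_close_pairs K z m \<Longrightarrow> \<exists>j<J. (take (k j) u, take (k j) v) \<in> T j"
  shows "\<exists>j<J. (1 - 2 / b) / (36 * real (Suc J)) * b ^ k j \<le> real (card (T j))"
proof (rule ccontr)
  define c where "c = (1 - 2 / b) / (36 * real (Suc J))"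
  have c: "0 < c" using b by (simp add: c_def)
  let ?N = "\<lambda>m. real (card (close_pairs K z m))" and ?P = "split_close_pairs K z m"
  have N_pos: "0 < ?N m" using card_close_pairs_pos_at_record_level[OF K _ rec] b by simp
  assume "\<not> ?thesis"
  then have few: "real (card (T j)) \<le> c * b ^ k j" if "j < J" for j
    using that unfolding c_def by (meson linear)
  define Q where "Q j = {(u, v) \<in> ?P. (take (k j) u, take (k j) v) \<in> T j}" for j
  have card_Q: "real (card (Q j)) \<le> 36 * c * ?N m" if "j < J" for j
  proof -
    have "card (Q j) \<le> card (T j) * (36 * card (close_pairs K z (m - k j)))"
      by (rule card_close_pairs_prefix_le[OF z K T]) (auto simp: Q_def split_close_pairs_def)
    then have "real (card (Q j)) \<le> real (card (T j) * (36 * card (close_pairs K z (m - k j))))"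
      by (simp only: of_nat_le_iff)
    also have "\<dots> \<le> c * b ^ k j * (36 * ?N (m - k j))"
      using few[OF that] by (simp add: mult_right_mono)
    also have "\<dots> = 36 * c * (?N (m - k j) * b ^ k j)" by simp
    also have "\<dots> \<le> 36 * c * ?N m"
      using c by (intro mult_left_mono record_levelD[OF rec T(1)]) simp
    finally show ?thesis .
  qed
  have "?P \<subseteq> (\<Union>j<J. Q j)"
  proof (rule subrelI)
    fix u v assume uv: "(u, v) \<in> ?P"
    then obtain j where "j < J" "(take (k j) u, take (k j) v) \<in> T j" using prefix by blast
    then show "(u, v) \<in> (\<Union>j<J. Q j)" using uv unfolding Q_def by blast
  qed
  then have "card ?P \<le> card (\<Union>j<J. Q j)"
    by (intro card_mono finite_UN_I finite_subset[OF _ finite_split_close_pairs]) (auto simp: Q_def)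
  also have "\<dots> \<le> (\<Sum>j<J. card (Q j))" by (rule card_UN_le) simp
  finally have "real (card ?P) \<le> (\<Sum>j<J. real (card (Q j)))" by (simp flip: of_nat_sum)
  also have "\<dots> \<le> real J * (36 * c * ?N m)"
    using sum_bounded_above[of "{..<J}" "\<lambda>j. real (card (Q j))" "36 * c * ?N m"] card_Q by simp
  also have "\<dots> < real (Suc J) * (36 * c * ?N m)"
    using c N_pos by (intro mult_strict_right_mono) auto
  also have "\<dots> = (1 - 2 / b) * ?N m" unfolding c_def by (simp del: of_nat_Suc)
  also have "\<dots> \<le> real (card ?P)"
    using b by (intro card_close_pairs_le_at_record_level z m rec) simp
  finally show False by simp
qed

lemma excess_growth_imp_frequently_rich_level:
  assumes R: "0 < R" "R < 1" and \<eta>: "1 < \<eta>" "\<eta> ^ 2 * R < 1" and K: "2 \<le> K" and b: "2 < b"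
  obtains J :: nat and c where "0 < c"
    "\<And>z. z \<noteq> 0 \<Longrightarrow> norm z \<le> R \<Longrightarrow> excess_growth K b z \<Longrightarrow>
       \<exists>\<^sub>F k in sequentially. \<exists>j\<in>{..<J}. z \<in> rich_level R \<eta> c b j k"
proof -
  obtain q where "1 / R < \<eta> ^ q" using real_arch_pow[OF \<eta>(1)] by blast
  then have q: "1 \<le> R * \<eta> ^ q" using R by (simp add: field_simps)
  then have "0 < q" using R by (cases q) auto
  obtain J n where prefix: "\<And>m u v z. n * q ^ J \<le> m \<Longrightarrow> norm z \<le> R \<Longrightarrow>
      (u, v) \<in> split_close_pairs K z m \<Longrightarrow>
      \<exists>j<J. (take (m div q ^ j) u, take (m div q ^ j) v) \<in> near_zero_scaled R \<eta> (m div q ^ j) j z"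
    by (rule split_close_pair_prefix_near_zeroE[OF R \<eta> K q]) blast
  define c where "c = (1 - 2 / b) / (36 * real (Suc J))"
  have "0 < c" using b by (simp add: c_def)
  moreover have "\<exists>k\<ge>k0. \<exists>j\<in>{..<J}. z \<in> rich_level R \<eta> c b j k"
    if z: "z \<noteq> 0" "norm z \<le> R" and excess: "excess_growth K b z" for z k0
  proof -
    obtain m where m: "Suc (n + k0) * q ^ J \<le> m" and rec: "record_level K b z m"
      using excess_growth_record_levelE[OF excess, of "Suc (n + k0) * q ^ J"] b by auto
    have "n * q ^ J \<le> Suc (n + k0) * q ^ J" by (intro mult_le_mono1) simp
    then have n: "n * q ^ J \<le> m" using m by (rule order_trans)
    have "0 < Suc (n + k0) * q ^ J" using \<open>0 < q\<close> by simp
    then have "m \<noteq> 0" using m by linarith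
    have "\<exists>j<J. c * b ^ (m div q ^ j) \<le> real (card (near_zero_scaled R \<eta> (m div q ^ j) j z))"
      unfolding c_def
      by (rule ex_many_prefixes_at_record_level[OF z(1) _ b \<open>m \<noteq> 0\<close> rec])
         (use K prefix[OF n z(2)] in \<open>auto simp: near_zero_scaled_def near_zero_pairs_def\<close>)
    then obtain j where j: "j < J"
      "c * b ^ (m div q ^ j) \<le> real (card (near_zero_scaled R \<eta> (m div q ^ j) j z))" by blast
    have "Suc (n + k0) \<le> m div q ^ j" using j(1) by (intro le_div_power[OF m _ \<open>0 < q\<close>]) simp
    then show ?thesis
      using j z(2) by (intro exI[of _ "m div q ^ j"])
        (auto simp: rich_level_def near_zero_rich_def near_zero_scaled_def)
  qed
  ultimately show ?thesis using that unfolding frequently_sequentially by blast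
qed

lemma near_zero_pairs_separateE:
  assumes "R < 1"
  obtains c where "0 < c" "\<And>\<rho> \<tau> k p z w. 0 < \<tau> \<Longrightarrow> norm z \<le> R \<Longrightarrow> norm w \<le> R \<Longrightarrow>
    p \<in> near_zero_pairs \<rho> \<tau> k i z \<Longrightarrow> p \<in> near_zero_pairs \<rho> \<tau> k i w \<Longrightarrow>
    dist z w \<le> c * \<tau> \<Longrightarrow> dist z w \<le> 4 * \<rho> / \<tau>"
proof -
  obtain c where c: "0 < c" and separates: "\<And>f z w \<rho> \<tau>. geometrically_bounded 2 f \<Longrightarrow>
      norm z \<le> R \<Longrightarrow> norm w \<le> R \<Longrightarrow>
      norm ((deriv ^^ i) f z) \<le> \<rho> \<Longrightarrow> norm ((deriv ^^ i) f w) \<le> \<rho> \<Longrightarrow>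
      \<tau> \<le> norm ((deriv ^^ Suc i) f z) \<Longrightarrow> norm (w - z) \<le> c * \<tau> \<Longrightarrow> \<tau> * norm (w - z) \<le> 4 * \<rho>"
    by (rule higher_deriv_separates[OF assms, of 2 i]) blast
  have "dist z w \<le> 4 * \<rho> / \<tau>"
    if "0 < \<tau>" "norm z \<le> R" "norm w \<le> R" "dist z w \<le> c * \<tau>"
      and p: "p \<in> near_zero_pairs \<rho> \<tau> k i z" "p \<in> near_zero_pairs \<rho> \<tau> k i w" for \<rho> \<tau> k p z w
  proof -
    obtain u v where "p = (u, v)" by (cases p)
    then have "\<tau> * norm (w - z) \<le> 4 * \<rho>"
      using that by (intro separates[OF geometrically_bounded_word_diff[of u k v]])
        (auto simp: near_zero_pairs_def dist_norm norm_minus_commute)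
    then show ?thesis
      using that(1) by (simp add: dist_norm norm_minus_commute pos_le_divide_eq mult.commute)
  qed
  then show ?thesis using that c by blast
qed

lemma near_zero_rich_coverE:
  assumes R: "0 < R" "R < 1"
  obtains d where "0 < d" "\<And>\<rho> \<tau> L k. 0 \<le> \<rho> \<Longrightarrow> 0 < \<tau> \<Longrightarrow> \<tau> \<le> 1 \<Longrightarrow> 0 < L \<Longrightarrow>
    \<exists>X. finite X \<and> near_zero_rich R \<rho> \<tau> L k i \<subseteq> (\<Union>x\<in>X. cball x (4 * \<rho> / \<tau>)) \<and>
      real (card X) \<le> d * 4 ^ k / (\<tau> ^ 2 * L)"
proof -
  obtain c where c: "0 < c" and separate: "\<And>\<rho> \<tau> k p z w. 0 < \<tau> \<Longrightarrow> norm z \<le> R \<Longrightarrow> norm w \<le> R \<Longrightarrow>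
      p \<in> near_zero_pairs \<rho> \<tau> k i z \<Longrightarrow> p \<in> near_zero_pairs \<rho> \<tau> k i w \<Longrightarrow>
      dist z w \<le> c * \<tau> \<Longrightarrow> dist z w \<le> 4 * \<rho> / \<tau>"
    by (rule near_zero_pairs_separateE[OF R(2), of i]) blast
  define e where "e = min c R"
  have e: "0 < e" "e \<le> c" "e \<le> R" using c R by (auto simp: e_def)
  have "\<exists>X. finite X \<and> near_zero_rich R \<rho> \<tau> L k i \<subseteq> (\<Union>x\<in>X. cball x (4 * \<rho> / \<tau>)) \<and>
      real (card X) \<le> 36 * (R / e) ^ 2 * 4 ^ k / (\<tau> ^ 2 * L)" (is "\<exists>X. finite X \<and> ?B \<subseteq> _ \<and> _")
    if \<rho>: "0 \<le> \<rho>" and \<tau>: "0 < \<tau>" "\<tau> \<le> 1" and L: "0 < L" for \<rho> \<tau> L k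
  proof -
    obtain X where X: "finite X" "?B \<subseteq> (\<Union>x\<in>X. cball x (4 * \<rho> / \<tau>))"
      "real (card X) \<le> 36 * (R / (e * \<tau>)) ^ 2 * real (card (words k \<times> words k)) / L"
    proof (rule cover_by_multiplicity[OF _ _ near_zero_pairs_subset L])
      show "?B \<subseteq> cball 0 R" by (auto simp: near_zero_rich_def)
      show "L \<le> real (card (near_zero_pairs \<rho> \<tau> k i z))" if "z \<in> ?B" for z
        using that by (simp add: near_zero_rich_def)
      show "0 < e * \<tau>" "e * \<tau> \<le> R" using e \<tau> mult_mono[of e R \<tau> 1] by auto
      show "0 \<le> 4 * \<rho> / \<tau>" using \<rho> \<tau> by simp
      show "dist z w \<le> 4 * \<rho> / \<tau>"
        if "z \<in> ?B" "w \<in> ?B" "p \<in> near_zero_pairs \<rho> \<tau> k i z" "p \<in> near_zero_pairs \<rho> \<tau> k i w"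
          and near: "dist z w \<le> e * \<tau>" for p z w
        using that \<tau> order_trans[OF near mult_right_mono[OF e(2)]]
        by (intro separate) (auto simp: near_zero_rich_def)
    qed auto
    have "real (card (words k \<times> words k)) = 4 ^ k"
      by (simp add: card_cartesian_product card_words flip: power_mult_distrib)
    then have "real (card X) \<le> 36 * (R / e) ^ 2 * 4 ^ k / (\<tau> ^ 2 * L)"
      using X(3) by (simp add: power_mult_distrib power_divide mult_ac)
    then show ?thesis using X by blast
  qed
  moreover have "0 < 36 * (R / e) ^ 2" using e R by simp
  ultimately show ?thesis using that by blast
qed

lemma hausdorff_pre_rich_level_le:
  assumes R: "0 < R" "R < 1" and \<eta>: "1 < \<eta>" and b: "0 < b" and c: "0 < c"
  obtains C where "0 \<le> C"
    "\<And>k \<delta>. 8 * (\<eta> ^ 2 * R) ^ k \<le> \<delta> \<Longrightarrow> hausdorff_pre s \<delta> (rich_level R \<eta> c b i k)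
      \<le> ennreal (C * (4 * \<eta> ^ 2 * (\<eta> ^ 2 * R) powr s / b) ^ k)"
proof -
  obtain d where d: "0 < d" and cover: "\<And>\<rho> \<tau> L k. 0 \<le> \<rho> \<Longrightarrow> 0 < \<tau> \<Longrightarrow> \<tau> \<le> 1 \<Longrightarrow> 0 < L \<Longrightarrow>
      \<exists>X. finite X \<and> near_zero_rich R \<rho> \<tau> L k i \<subseteq> (\<Union>x\<in>X. cball x (4 * \<rho> / \<tau>)) \<and>
        real (card X) \<le> d * 4 ^ k / (\<tau> ^ 2 * L)"
    by (rule near_zero_rich_coverE[OF R, of i]) blast
  have \<eta>_pos: "0 < \<eta>" "0 < \<eta> ^ 2 * R" using \<eta> R by auto
  have "hausdorff_pre s \<delta> (rich_level R \<eta> c b i k)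
      \<le> ennreal (d / c * 8 powr s * (4 * \<eta> ^ 2 * (\<eta> ^ 2 * R) powr s / b) ^ k)"
    if \<delta>: "8 * (\<eta> ^ 2 * R) ^ k \<le> \<delta>" for k \<delta>
  proof -
    let ?r = "4 * (\<eta> ^ 2 * R) ^ k" and ?N = "d * 4 ^ k / (((1 / \<eta>) ^ k) ^ 2 * (c * b ^ k))"
    have radius: "4 * (\<eta> * R) ^ k / (1 / \<eta>) ^ k = ?r"
      using \<eta>_pos by (simp add: power_mult_distrib power_divide power2_eq_square)
    have "0 \<le> (\<eta> * R) ^ k" "0 < (1 / \<eta>) ^ k" "(1 / \<eta>) ^ k \<le> 1" "0 < c * b ^ k"
      using R \<eta> c b by (auto intro: power_le_one)
    from cover[OF this] obtain X where X: "finite X"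
      "rich_level R \<eta> c b i k \<subseteq> (\<Union>x\<in>X. cball x ?r)" "real (card X) \<le> ?N"
      unfolding rich_level_def radius by blast
    have "hausdorff_pre s \<delta> (rich_level R \<eta> c b i k) \<le> ennreal (real (card X) * (2 * ?r) powr s)"
      using \<delta> \<eta>_pos by (intro hausdorff_pre_finite_cball_cover X) auto
    also have "\<dots> \<le> ennreal (?N * (2 * ?r) powr s)"
      by (intro ennreal_leI mult_right_mono X(3)) simp
    also have "(2 * ?r) powr s = 8 powr s * ((\<eta> ^ 2 * R) powr s) ^ k"
      using \<eta>_pos by (simp add: powr_mult power_powr_eq_powr_power)
    also have "((1 / \<eta>) ^ k) ^ 2 = 1 / (\<eta> ^ 2) ^ k"
      by (simp add: power_divide mult.commute flip: power_mult)
    also have "d * 4 ^ k / (1 / (\<eta> ^ 2) ^ k * (c * b ^ k)) * (8 powr s * ((\<eta> ^ 2 * R) powr s) ^ k)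
        = d / c * 8 powr s * (4 * \<eta> ^ 2 * (\<eta> ^ 2 * R) powr s / b) ^ k"
      using c b \<eta>_pos by (simp add: power_mult_distrib power_divide)
    finally show ?thesis .
  qed
  then show ?thesis using that[of "d / c * 8 powr s"] d c by simp
qed

lemma hausdorff_measure_frequently_rich_level_eq_0:
  assumes R: "0 < R" "R < 1" and \<eta>: "1 < \<eta>" "\<eta> ^ 2 * R < 1"
    and b: "4 * \<eta> ^ 2 * (\<eta> ^ 2 * R) powr s < b" and c: "0 < c"
  shows "hausdorff_measure s {z. \<exists>\<^sub>F k in sequentially. z \<in> rich_level R \<eta> c b i k} = 0"
proof -
  define x where "x = 4 * \<eta> ^ 2 * (\<eta> ^ 2 * R) powr s / b"
  have "0 \<le> 4 * \<eta> ^ 2 * (\<eta> ^ 2 * R) powr s" by simp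
  then have "0 < b" using b by (rule le_less_trans)
  then have x: "0 \<le> x" "x < 1" using b by (auto simp: x_def)
  obtain C where C: "0 \<le> C" "\<And>k \<delta>. 8 * (\<eta> ^ 2 * R) ^ k \<le> \<delta> \<Longrightarrow>
      hausdorff_pre s \<delta> (rich_level R \<eta> c b i k) \<le> ennreal (C * x ^ k)"
    unfolding x_def by (rule hausdorff_pre_rich_level_le[OF R \<eta>(1) \<open>0 < b\<close> c, of s i]) blast
  show ?thesis
  proof (rule hausdorff_measure_limsup_eq_0)
    show "summable (\<lambda>k. C * x ^ k)" using x by (intro summable_mult summable_geometric) simp
    show "0 \<le> C * x ^ k" for k using C x by simp
    fix \<delta> :: real assume "0 < \<delta>"
    have "(\<lambda>k. 8 * (\<eta> ^ 2 * R) ^ k) \<longlonglongrightarrow> 8 * 0"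
      using \<eta> R by (intro tendsto_mult_left LIMSEQ_power_zero) simp
    then have "\<forall>\<^sub>F k in sequentially. 8 * (\<eta> ^ 2 * R) ^ k < \<delta>"
      using \<open>0 < \<delta>\<close> by (intro order_tendstoD) auto
    then show "\<forall>\<^sub>F k in sequentially.
        hausdorff_pre s \<delta> (rich_level R \<eta> c b i k) \<le> ennreal (C * x ^ k)"
      by (rule eventually_mono) (intro C(2) less_imp_le)
  qed
qed

lemma ex_dilation_gt_1:
  fixes R s b :: real
  assumes R: "0 < R" "R < 1" and s: "R powr s = 1/2" and b: "2 < b"
  obtains \<eta> where "1 < \<eta>" "\<eta> ^ 2 * R < 1" "4 * \<eta> ^ 2 * (\<eta> ^ 2 * R) powr s < b"
proof -
  have "((\<lambda>\<eta>. \<eta> ^ 2 * R) \<longlongrightarrow> 1 ^ 2 * R) (at_right 1)"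
    by (intro tendsto_intros)
  then have "\<forall>\<^sub>F \<eta> in at_right 1. \<eta> ^ 2 * R < 1" using R by (intro order_tendstoD) auto
  moreover have "((\<lambda>\<eta>. 4 * \<eta> ^ 2 * (\<eta> ^ 2 * R) powr s) \<longlongrightarrow> 4 * 1 ^ 2 * (1 ^ 2 * R) powr s)
      (at_right 1)"
    using R by (intro tendsto_intros) auto
  then have "\<forall>\<^sub>F \<eta> in at_right 1. 4 * \<eta> ^ 2 * (\<eta> ^ 2 * R) powr s < b"
    using s b by (intro order_tendstoD) auto
  ultimately have "\<forall>\<^sub>F \<eta> in at_right (1::real).
      1 < \<eta> \<and> \<eta> ^ 2 * R < 1 \<and> 4 * \<eta> ^ 2 * (\<eta> ^ 2 * R) powr s < b"
    using eventually_at_right_less[of "1::real"] by eventually_elim simp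
  then show ?thesis using that eventually_happens'[OF trivial_limit_at_right_real] by blast
qed

lemma hausdorff_measure_excess_growth_eq_0:
  assumes R: "0 < R" "R < 1" and s: "R powr s = 1/2" and K: "2 \<le> K" and b: "2 < b"
  shows "hausdorff_measure s {z. z \<noteq> 0 \<and> norm z \<le> R \<and> excess_growth K b z} = 0"
proof -
  obtain \<eta> where \<eta>: "1 < \<eta>" "\<eta> ^ 2 * R < 1" and small: "4 * \<eta> ^ 2 * (\<eta> ^ 2 * R) powr s < b"
    by (rule ex_dilation_gt_1[OF R s b])
  obtain J :: nat and c where c: "0 < c" and many: "\<And>z. z \<noteq> 0 \<Longrightarrow> norm z \<le> R \<Longrightarrow> excess_growth K b z \<Longrightarrow>
      \<exists>\<^sub>F k in sequentially. \<exists>j\<in>{..<J}. z \<in> rich_level R \<eta> c b j k"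
    by (rule excess_growth_imp_frequently_rich_level[OF R \<eta> K b]) blast
  let ?L = "\<lambda>j. {z. \<exists>\<^sub>F k in sequentially. z \<in> rich_level R \<eta> c b j k}"
  have "{z. z \<noteq> 0 \<and> norm z \<le> R \<and> excess_growth K b z} \<subseteq> (\<Union>j. ?L j)"
    using frequently_bex_finite[OF finite_lessThan many] by blast
  moreover have "hausdorff_measure s (\<Union>j. ?L j) = 0"
    by (intro hausdorff_measure_eq_0_UN hausdorff_measure_frequently_rich_level_eq_0
        R \<eta> small c)
  ultimately show ?thesis by (rule hausdorff_measure_eq_0_subset[rotated])
qed

section \<open>Dimension drop\<close>

lemma similarity_exponent_powr:
  fixes R :: real
  assumes "0 < R" "R < 1" shows "R powr (ln 2 / (- ln R)) = 1/2"
proof -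
  have "ln R \<noteq> 0" using assms by simp
  then show ?thesis using assms by (simp add: powr_def exp_minus)
qed

lemma similarity_exponent_bounds:
  fixes R :: real
  assumes "0 < R" "R < 1 / sqrt 2"
  shows "0 < ln 2 / (- ln R)" "ln 2 / (- ln R) < 2"
proof -
  have "ln R < ln (1 / sqrt 2)" using assms by (subst ln_less_cancel_iff) auto
  also have "ln (1 / sqrt 2) = - (ln 2 / 2)" by (simp add: ln_div ln_sqrt)
  finally have less: "ln 2 / 2 < - ln R" by simp
  moreover have "0 < ln (2::real)" by simp
  ultimately have pos: "0 < - ln R" by linarith
  show "0 < ln 2 / (- ln R)" using pos by (intro divide_pos_pos) auto
  show "ln 2 / (- ln R) < 2" using less pos by (subst pos_divide_less_eq) auto
qed

lemma sim_dim_pos: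
  assumes "0 < norm z" "norm z < 1" shows "0 < sim_dim z"
  unfolding sim_dim_def using assms by (intro divide_pos_pos) auto

lemma norm_powr_sim_dim:
  assumes "0 < norm z" "norm z < 1" shows "norm z powr sim_dim z = 1/2"
  unfolding sim_dim_def by (rule similarity_exponent_powr[OF assms])

lemma hausdorff_dim_le:
  assumes "0 < s" "hausdorff_measure s E = 0" shows "hausdorff_dim E \<le> s"
  unfolding hausdorff_dim_def by (rule cInf_lower) (use assms in \<open>auto intro: bdd_belowI[of _ 0]\<close>)

lemma hausdorff_measure_A_set_above_sim_dim:
  assumes z: "0 < norm z" "norm z < 1" and t: "sim_dim z < t"
  shows "hausdorff_measure t (A_set z) = 0"
  using powr_less_mono'[OF z t] norm_powr_sim_dim[OF z]
  by (intro hausdorff_measure_A_set_eq_0 z) simp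

lemma hausdorff_dim_A_set_le:
  assumes z: "0 < norm z" "norm z < 1" shows "hausdorff_dim (A_set z) \<le> sim_dim z"
proof (rule dense_ge)
  fix t assume "sim_dim z < t"
  then show "hausdorff_dim (A_set z) \<le> t"
    using sim_dim_pos[OF z] by (intro hausdorff_dim_le hausdorff_measure_A_set_above_sim_dim z) auto
qed

definition dimension_drop :: "real \<Rightarrow> complex set" where
  "dimension_drop R = {z. 0 < norm z \<and> norm z < R \<and> hausdorff_dim (A_set z) < sim_dim z}"

lemma dimension_drop_imp_excess_growth:
  assumes drop: "z \<in> dimension_drop 1" and K: "1 + 2 / (1 - norm z) \<le> K"
  shows "\<exists>n. excess_growth K (2 + inverse (real (Suc n))) z"
proof -
  have z: "0 < norm z" "norm z < 1" and less: "hausdorff_dim (A_set z) < sim_dim z"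
    using drop by (auto simp: dimension_drop_def)
  have "sim_dim z + 1 \<in> {s. 0 < s \<and> hausdorff_measure s (A_set z) = 0}"
    using hausdorff_measure_A_set_above_sim_dim[OF z] sim_dim_pos[OF z] by simp
  then obtain t where t: "0 < t" "hausdorff_measure t (A_set z) = 0" "t < sim_dim z"
    using cInf_lessD[OF _ less[unfolded hausdorff_dim_def]] by blast
  have "1/2 < norm z powr t"
    using powr_less_mono'[OF z t(3)] norm_powr_sim_dim[OF z] by simp
  then obtain n where "inverse (real (Suc n)) < 4 * norm z powr t - 2"
    using reals_Archimedean[of "4 * norm z powr t - 2"] by auto
  moreover have "0 < inverse (real (Suc n))" by simp
  ultimately have "0 < 2 + inverse (real (Suc n))" "2 + inverse (real (Suc n)) < 4 * norm z powr t"
    by linarith+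
  then show ?thesis using hausdorff_measure_A_set_neq_0[OF z K _ _ _ t(1)] t(2) by blast
qed

lemma hausdorff_measure_dimension_drop_eq_0:
  assumes R: "0 < R" "R < 1"
  shows "hausdorff_measure (ln 2 / (- ln R)) (dimension_drop R) = 0"
proof -
  define K where "K = 1 + 2 / (1 - R)"
  have K: "2 \<le> K" using R by (simp add: K_def field_simps)
  let ?E = "\<lambda>n. {z. z \<noteq> 0 \<and> norm z \<le> R \<and> excess_growth K (2 + inverse (real (Suc n))) z}"
  have "dimension_drop R \<subseteq> (\<Union>n. ?E n)"
  proof
    fix z assume drop: "z \<in> dimension_drop R"
    then have z: "0 < norm z" "norm z < R" by (auto simp: dimension_drop_def)
    have "1 + 2 / (1 - norm z) \<le> K"
      unfolding K_def using z R by (intro add_left_mono divide_left_mono mult_pos_pos) auto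
    moreover have "z \<in> dimension_drop 1" using drop R by (simp add: dimension_drop_def)
    ultimately have "\<exists>n. excess_growth K (2 + inverse (real (Suc n))) z"
      by (intro dimension_drop_imp_excess_growth)
    then show "z \<in> (\<Union>n. ?E n)" using z by auto
  qed
  moreover have "hausdorff_measure (ln 2 / (- ln R)) (\<Union>n. ?E n) = 0"
    by (intro hausdorff_measure_eq_0_UN hausdorff_measure_excess_growth_eq_0
        R K similarity_exponent_powr) simp
  ultimately show ?thesis by (rule hausdorff_measure_eq_0_subset[rotated])
qed

lemma less_1_of_less_inverse_sqrt_2: "x < 1 / sqrt 2 \<Longrightarrow> x < (1::real)"
  by (erule less_le_trans) simp

lemma negligible_dimension_drop: "negligible (dimension_drop (1 / sqrt 2))" (is "negligible ?D")
proof (rule locally_negligible_alt[THEN iffD2], rule ballI)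
  fix z assume z: "z \<in> ?D"
  then obtain R where R: "norm z < R" "R < 1 / sqrt 2"
    using dense unfolding dimension_drop_def by blast
  have "0 < R" using norm_ge_zero R(1) by (rule le_less_trans)
  have "negligible (dimension_drop R)"
    using similarity_exponent_bounds(2)[OF \<open>0 < R\<close> R(2)]
      hausdorff_measure_dimension_drop_eq_0[OF \<open>0 < R\<close> less_1_of_less_inverse_sqrt_2[OF R(2)]]
    by (intro hausdorff_null_imp_negligible) auto
  then have "negligible (?D \<inter> ball 0 R)"
    by (rule negligible_subset) (auto simp: dimension_drop_def)
  moreover have "openin (top_of_set ?D) (?D \<inter> ball 0 R)" by (intro openin_open_Int open_ball)
  ultimately show "\<exists>U. openin (top_of_set ?D) U \<and> z \<in> U \<and> negligible U"
    using z R(1) by (intro exI[of _ "?D \<inter> ball 0 R"]) simp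
qed

lemma M_set_norm_pos: "z \<in> M_set \<Longrightarrow> 0 < norm z"
  by (auto simp: M_set_def)

theorem mainTheorem14:
  shows "{z \<in> M_set \<inter> ball 0 (1 / sqrt 2). hausdorff_dim (A_set z) \<noteq> sim_dim z}
           \<in> null_sets lebesgue
    \<and> (\<forall>r R :: real. 0 < r \<and> r < R \<and> R < 1 / sqrt 2 \<longrightarrow>
         hausdorff_dim {z \<in> M_set. r < norm z \<and> norm z < R \<and>
                                    hausdorff_dim (A_set z) < sim_dim z}
           \<le> ln 2 / (- ln R)
         \<and> ln 2 / (- ln R) < 2)"
proof (intro conjI allI impI)
  let ?N = "{z \<in> M_set \<inter> ball 0 (1 / sqrt 2). hausdorff_dim (A_set z) \<noteq> sim_dim z}"
  have "hausdorff_dim (A_set z) \<le> sim_dim z" if "z \<in> ?N" for z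
    using that M_set_norm_pos less_1_of_less_inverse_sqrt_2 by (intro hausdorff_dim_A_set_le) auto
  then have "?N \<subseteq> dimension_drop (1 / sqrt 2)"
    using M_set_norm_pos by (force simp: dimension_drop_def)
  then show "?N \<in> null_sets lebesgue"
    using negligible_subset[OF negligible_dimension_drop] negligible_iff_null_sets by blast
next
  fix r R :: real assume "0 < r \<and> r < R \<and> R < 1 / sqrt 2"
  then have R: "0 < R" "R < 1 / sqrt 2" by auto
  show "ln 2 / (- ln R) < 2" by (rule similarity_exponent_bounds(2)[OF R])
  let ?E = "{z \<in> M_set. r < norm z \<and> norm z < R \<and> hausdorff_dim (A_set z) < sim_dim z}"
  have "?E \<subseteq> dimension_drop R" using M_set_norm_pos by (auto simp: dimension_drop_def)
  then have "hausdorff_measure (ln 2 / (- ln R)) ?E = 0"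
    using hausdorff_measure_dimension_drop_eq_0[OF R(1) less_1_of_less_inverse_sqrt_2[OF R(2)]]
    by (rule hausdorff_measure_eq_0_subset[rotated])
  then show "hausdorff_dim ?E \<le> ln 2 / (- ln R)"
    by (rule hausdorff_dim_le[OF similarity_exponent_bounds(1)[OF R]])
qed

end
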